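(* Let $\mathrm{L}$ be a relational language, $\mathcal{M}$ an $\mathrm{L}$-structure and $\mathfrak{N}=\{\mathcal{N}_a\}_{a\in\mathcal{M}}$ a collection of $\mathrm{L}$-structures indexed by $\mathcal{M}$. Assume that for every sentence $\phi\in\mathrm{L}$, the set $\{a\in\mathcal{M}\mid\mathcal{N}_a\models\phi\}$ is $\emptyset$-definable in $\mathcal{M}$. Assume also: - $(QE)_\mathfrak{N}$: for each $\mathrm{L}$-formula $\phi(\bar{x})$ there are $k\in\mathbb{N}$ and quantifier-free $\mathrm{L}$-formulas $\phi_i(\bar{x})$, $i<k$, such that for all models $\mathcal{N}$ of $\mathrm{Th}(\mathfrak{N})$ there is $i<k$ with $\mathcal{N}\models\forall\bar{x}\ \phi(\bar{x})\leftrightarrow\phi_i(\bar{x})$; - $(QE)_\mathcal{M}$: $\mathcal{M}$ eliminates quantifiers in $\mathrm{L}$. Then the lexicographic product $\mathcal{M}[\mathfrak{N}^s]^{\mathbb{U}}$ eliminates quantifiers in $\mathrm{L}_{\mathbb{U},s}$.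
   Context: $\mathrm{Th}(\mathfrak{N})$ is the common theory of all the $\mathcal{N}_a$, $a\in\mathcal{M}$. The (generalised) lexicographic product $\mathcal{M}[\mathfrak{N}^s]^{\mathbb{U}}$ is a structure in the language $\mathrm{L}_{\mathbb{U},s}=\mathrm{L}\cup\{R^{\mathbb{U}}\}_{R\in\mathrm{L}}\cup\{s\}$, where the $R^{\mathbb{U}}$ are new unary predicates and $s$ is a binary predicate. Its base set is $\bigcup_{a\in\mathcal{M}}\{a\}\times\mathcal{N}_a$, and: - $s:=\{((a,b),(a,b'))\mid a\in\mathcal{M},\ b,b'\in\mathcal{N}_a\}$; - for an $n$-ary $R\in\mathrm{L}$, $R$ is interpreted as $\{((a,b_1),\dots,(a,b_n))\mid a\in\mathcal{M},\ \mathcal{N}_a\models R(b_1,\dots,b_n)\}\cup\{((a_1,b_1),\dots,(a_n,b_n))\mid a_i\ne a_j\text{ for some }i<j,\text{ and }\mathcal{M}\models R(a_1,\dots,a_n)\}$; - for an $n$-ary $R\in\mathrm{L}$, $R^{\mathbb{U}}:=\{(a,b)\mid\mathcal{M}\models R(a,\dots,a)\}$ ($n$ times $a$). *)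

theory Defs
  imports Main
begin

text \<open>
  A relational language is a partial map from symbols to arities; symbols mapped to \<open>None\<close> are
  not in the language (so the empty language is covered although HOL types are nonempty).
  Nullary relation symbols are allowed.
\<close>

type_synonym 'r lang = "'r \<rightharpoonup> nat"

text \<open>
  First-order formulas with equality over named variables. The constant \<open>FBot\<close> ensures that
  quantifier-free sentences exist, as the languages have no constant symbols.
\<close>

datatype 'r fm =
    FBot
  | FEq nat nat
  | FRel 'r "nat list"
  | FNeg "'r fm"
  | FConj "'r fm" "'r fm"
  | FEx nat "'r fm"

fun formula_of :: "'r lang \<Rightarrow> 'r fm \<Rightarrow> bool" where
  "formula_of L FBot \<longleftrightarrow> True"
| "formula_of L (FEq x y) \<longleftrightarrow> True"
| "formula_of L (FRel R xs) \<longleftrightarrow> L R = Some (length xs)"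
| "formula_of L (FNeg \<phi>) \<longleftrightarrow> formula_of L \<phi>"
| "formula_of L (FConj \<phi> \<psi>) \<longleftrightarrow> formula_of L \<phi> \<and> formula_of L \<psi>"
| "formula_of L (FEx x \<phi>) \<longleftrightarrow> formula_of L \<phi>"

fun qfree :: "'r fm \<Rightarrow> bool" where
  "qfree FBot \<longleftrightarrow> True"
| "qfree (FEq x y) \<longleftrightarrow> True"
| "qfree (FRel R xs) \<longleftrightarrow> True"
| "qfree (FNeg \<phi>) \<longleftrightarrow> qfree \<phi>"
| "qfree (FConj \<phi> \<psi>) \<longleftrightarrow> qfree \<phi> \<and> qfree \<psi>"
| "qfree (FEx x \<phi>) \<longleftrightarrow> False"

fun fv :: "'r fm \<Rightarrow> nat set" where
  "fv FBot = {}"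
| "fv (FEq x y) = {x, y}"
| "fv (FRel R xs) = set xs"
| "fv (FNeg \<phi>) = fv \<phi>"
| "fv (FConj \<phi> \<psi>) = fv \<phi> \<union> fv \<psi>"
| "fv (FEx x \<phi>) = fv \<phi> - {x}"

definition sentence_of :: "'r lang \<Rightarrow> 'r fm \<Rightarrow> bool" where
  "sentence_of L \<phi> \<longleftrightarrow> formula_of L \<phi> \<and> fv \<phi> = {}"

record ('r, 'a) fo_struct =
  base :: "'a set"
  interp :: "'r \<Rightarrow> 'a list set"

definition structure_of :: "'r lang \<Rightarrow> ('r, 'a) fo_struct \<Rightarrow> bool" where
  "structure_of L M \<longleftrightarrow> base M \<noteq> {} \<and>
     (\<forall>R n. L R = Some n \<longrightarrow> interp M R \<subseteq> {as. length as = n \<and> set as \<subseteq> base M})"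

fun sat :: "('r, 'a) fo_struct \<Rightarrow> (nat \<Rightarrow> 'a) \<Rightarrow> 'r fm \<Rightarrow> bool" where
  "sat M v FBot \<longleftrightarrow> False"
| "sat M v (FEq x y) \<longleftrightarrow> v x = v y"
| "sat M v (FRel R xs) \<longleftrightarrow> map v xs \<in> interp M R"
| "sat M v (FNeg \<phi>) \<longleftrightarrow> \<not> sat M v \<phi>"
| "sat M v (FConj \<phi> \<psi>) \<longleftrightarrow> sat M v \<phi> \<and> sat M v \<psi>"
| "sat M v (FEx x \<phi>) \<longleftrightarrow> (\<exists>a \<in> base M. sat M (v(x := a)) \<phi>)"

text \<open>Truth in a structure, used for sentences (for other formulas: of the universal closure).\<close>

definition holds :: "('r, 'a) fo_struct \<Rightarrow> 'r fm \<Rightarrow> bool" where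
  "holds M \<phi> \<longleftrightarrow> (\<forall>v. range v \<subseteq> base M \<longrightarrow> sat M v \<phi>)"

definition equiv_in :: "('r, 'a) fo_struct \<Rightarrow> 'r fm \<Rightarrow> 'r fm \<Rightarrow> bool" where
  "equiv_in M \<phi> \<psi> \<longleftrightarrow> (\<forall>v. range v \<subseteq> base M \<longrightarrow> (sat M v \<phi> \<longleftrightarrow> sat M v \<psi>))"

definition eliminates_quantifiers :: "'r lang \<Rightarrow> ('r, 'a) fo_struct \<Rightarrow> bool" where
  "eliminates_quantifiers L M \<longleftrightarrow>
     (\<forall>\<phi>. formula_of L \<phi> \<longrightarrow>
       (\<exists>\<psi>. formula_of L \<psi> \<and> qfree \<psi> \<and> fv \<psi> \<subseteq> fv \<phi> \<and> equiv_in M \<phi> \<psi>))"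

text \<open>Definability without parameters; \<open>x\<close> is the only variable allowed to be free in \<open>\<psi>\<close>.\<close>

definition zero_definable :: "'r lang \<Rightarrow> ('r, 'a) fo_struct \<Rightarrow> 'a set \<Rightarrow> bool" where
  "zero_definable L M D \<longleftrightarrow>
     (\<exists>\<psi> x. formula_of L \<psi> \<and> fv \<psi> \<subseteq> {x} \<and> D = {a \<in> base M. sat M (\<lambda>_. a) \<psi>})"

definition common_theory ::
  "'r lang \<Rightarrow> ('r, 'a) fo_struct \<Rightarrow> ('a \<Rightarrow> ('r, 'b) fo_struct) \<Rightarrow> 'r fm set" where
  "common_theory L M N = {\<phi>. sentence_of L \<phi> \<and> (\<forall>a \<in> base M. holds (N a) \<phi>)}"

definition model_of :: "'r lang \<Rightarrow> 'r fm set \<Rightarrow> ('r, 'c) fo_struct \<Rightarrow> bool" where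
  "model_of L T K \<longleftrightarrow> structure_of L K \<and> (\<forall>\<phi> \<in> T. holds K \<phi>)"

text \<open>
  HOL cannot quantify over all models of a theory irrespective of their type, so the type \<open>'c\<close> in
  which the base sets of the models live is a parameter. Whether a model satisfies
  \<open>equiv_in K \<phi> (\<Phi> i)\<close> depends only on its complete theory, so by the downward
  Loewenheim-Skolem theorem the definition captures all models of \<open>T\<close> as soon as \<open>'c\<close> has
  cardinality at least \<open>max (aleph_0, |L|)\<close>, e.g. if \<open>nat + 'r\<close> embeds into \<open>'c\<close>
  (base sets are arbitrary nonempty subsets of \<open>'c\<close>).
\<close>

definition uniform_QE :: "'c itself \<Rightarrow> 'r lang \<Rightarrow> 'r fm set \<Rightarrow> bool" where
  "uniform_QE (_ :: 'c itself) L T \<longleftrightarrow>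
     (\<forall>\<phi>. formula_of L \<phi> \<longrightarrow>
       (\<exists>(k :: nat) (\<Phi> :: nat \<Rightarrow> 'r fm).
          (\<forall>i<k. formula_of L (\<Phi> i) \<and> qfree (\<Phi> i) \<and> fv (\<Phi> i) \<subseteq> fv \<phi>) \<and>
          (\<forall>K :: ('r, 'c) fo_struct. model_of L T K \<longrightarrow> (\<exists>i<k. equiv_in K \<phi> (\<Phi> i)))))"

text \<open>
  Symbols of the language of the product: \<open>Orig R\<close> is the symbol \<open>R\<close> of the given language,
  \<open>Unary R\<close> is the new unary predicate attached to it, \<open>Same\<close> is the predicate \<open>s\<close>.
\<close>

datatype 'r usym = Orig 'r | Unary 'r | Same

fun lang_Us :: "'r lang \<Rightarrow> 'r usym lang" where
  "lang_Us L (Orig R) = L R"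
| "lang_Us L (Unary R) = (if L R = None then None else Some 1)"
| "lang_Us L Same = Some 2"

fun lex_interp ::
  "'r lang \<Rightarrow> ('r, 'a) fo_struct \<Rightarrow> ('a \<Rightarrow> ('r, 'b) fo_struct) \<Rightarrow> 'r usym \<Rightarrow> ('a \<times> 'b) list set"
where
  "lex_interp L M N (Orig R) =
     {map (Pair a) bs | a bs. a \<in> base M \<and> bs \<in> interp (N a) R} \<union>
     {ps. set ps \<subseteq> (SIGMA a : base M. base (N a)) \<and>
          (\<exists>i j. i < j \<and> j < length ps \<and> fst (ps ! i) \<noteq> fst (ps ! j)) \<and>
          map fst ps \<in> interp M R}"
| "lex_interp L M N (Unary R) =
     {[(a, b)] | a b. a \<in> base M \<and> b \<in> base (N a) \<and> replicate (the (L R)) a \<in> interp M R}"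
| "lex_interp L M N Same =
     {[(a, b), (a, b')] | a b b'. a \<in> base M \<and> b \<in> base (N a) \<and> b' \<in> base (N a)}"

definition lex_product ::
  "'r lang \<Rightarrow> ('r, 'a) fo_struct \<Rightarrow> ('a \<Rightarrow> ('r, 'b) fo_struct) \<Rightarrow> ('r usym, 'a \<times> 'b) fo_struct"
where
  "lex_product L M N =
     \<lparr>base = (SIGMA a : base M. base (N a)), interp = lex_interp L M N\<rparr>"

lemma structure_of_lex_product:
  fixes M :: "('r, 'a) fo_struct" and N :: "'a \<Rightarrow> ('r, 'b) fo_struct"
  assumes M: "structure_of L M" and N: "\<And>a. a \<in> base M \<Longrightarrow> structure_of L (N a)"
  shows "structure_of (lang_Us L) (lex_product L M N)"
proof -
  have "lex_interp L M N S \<subseteq> {ps. length ps = n \<and> set ps \<subseteq> (SIGMA a : base M. base (N a))}"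
    if "lang_Us L S = Some n" for S n
  proof (cases S)
    case (Orig R)
    then have R: "L R = Some n"
      using that by simp
    have "length bs = n \<and> set bs \<subseteq> base (N a)" if "a \<in> base M" "bs \<in> interp (N a) R" for a bs
      using N[OF that(1)] that(2) R unfolding structure_of_def by blast
    moreover have "length ps = n" if "map fst ps \<in> interp M R" for ps :: "('a \<times> 'b) list"
    proof -
      have "length (map fst ps) = n"
        using M R that unfolding structure_of_def by blast
      then show ?thesis by simp
    qed
    ultimately show ?thesis
      using Orig by fastforce
  qed (use that in \<open>auto split: if_splits\<close>)
  moreover have "(SIGMA a : base M. base (N a)) \<noteq> {}"
    using M N unfolding structure_of_def by fastforce
  ultimately show ?thesis
    by (simp add: structure_of_def lex_product_def)
qed

end

theory Submission
  imports Defs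
begin

text \<open>
  The argument is of Feferman-Vaught type. The truth in the product of a formula at a tuple
  \<open>(a\<^sub>i, b\<^sub>i)\<close> depends only on which of the \<open>a\<^sub>i\<close> coincide, on the truth values of finitely many
  formulas in \<open>M\<close> at the \<open>a\<^sub>i\<close>, and on the truth values, for each fibre, of finitely many formulas
  in that fibre at those \<open>b\<^sub>i\<close> that lie in it; existential quantifiers are treated by an
  Ehrenfeucht-Fraisse step. Each of these data is quantifier-free definable in the product:
  the first by \<open>s\<close>, the second by quantifier elimination in \<open>M\<close>, and the third because the
  quantifier-free equivalent valid in a fibre is one of finitely many, the choice being made by a
  sentence and hence by a definable condition on the first coordinate. Sentences are
  trivial, since a single structure decides them; so a free variable is always available when a
  nullary symbol of \<open>M\<close> has to be expressed by a unary predicate.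
\<close>

section \<open>Free variables and coincidence of valuations\<close>

lemma finite_fv: "finite (fv \<phi>)"
  by (induction \<phi>) auto

lemma sat_cong:
  assumes "\<And>x. x \<in> fv \<phi> \<Longrightarrow> v x = w x"
  shows "sat M v \<phi> \<longleftrightarrow> sat M w \<phi>"
  using assms
proof (induction \<phi> arbitrary: v w)
  case (FRel R xs)
  then have "map v xs = map w xs" by simp
  then show ?case by (simp only: sat.simps)
next
  case (FNeg \<phi>)
  then show ?case by (metis fv.simps(4) sat.simps(4))
next
  case (FConj \<phi> \<psi>)
  then show ?case by (metis UnCI fv.simps(5) sat.simps(5))
next
  case (FEx x \<phi>)
  have "sat M (v(x := a)) \<phi> \<longleftrightarrow> sat M (w(x := a)) \<phi>" for a
    by (rule FEx.IH) (use FEx.prems in auto)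
  then show ?case by simp
qed simp_all

section \<open>Finite Boolean combinations of formulas\<close>

text \<open>\<open>T\<close> marks the members of the finite set \<open>F\<close> that are asserted;
  the rest are negated. The enumeration of \<open>F\<close> is arbitrary, as its order does not
  affect satisfaction; \<open>FNeg FBot\<close> is truth, the conjunction over the empty
  set.\<close>

definition diagram :: "'r fm set \<Rightarrow> 'r fm set \<Rightarrow> 'r fm" where
  "diagram F T =
     foldr (\<lambda>\<phi>. FConj (if \<phi> \<in> T then \<phi> else FNeg \<phi>)) (SOME fs. set fs = F) (FNeg FBot)"

lemma set_some_list: "finite F \<Longrightarrow> set (SOME fs. set fs = F) = F"
  using someI_ex[of "\<lambda>fs. set fs = F"] finite_list by blast

lemma sat_diagram:
  assumes "finite F"
  shows "sat M v (diagram F T) \<longleftrightarrow> (\<forall>\<phi>\<in>F. sat M v \<phi> \<longleftrightarrow> \<phi> \<in> T)"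
proof -
  have "sat M v (foldr (\<lambda>\<phi>. FConj (if \<phi> \<in> T then \<phi> else FNeg \<phi>)) fs (FNeg FBot)) \<longleftrightarrow>
      (\<forall>\<phi>\<in>set fs. sat M v \<phi> \<longleftrightarrow> \<phi> \<in> T)" for fs
    by (induction fs) auto
  then show ?thesis
    by (simp add: diagram_def set_some_list[OF assms])
qed

lemma fv_diagram:
  assumes "finite F"
  shows "fv (diagram F T) = (\<Union>\<phi>\<in>F. fv \<phi>)"
proof -
  have "fv (foldr (\<lambda>\<phi>. FConj (if \<phi> \<in> T then \<phi> else FNeg \<phi>)) fs (FNeg FBot)) =
      (\<Union>\<phi>\<in>set fs. fv \<phi>)" for fs
    by (induction fs) auto
  then show ?thesis
    by (simp add: diagram_def set_some_list[OF assms])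
qed

lemma formula_of_diagram:
  assumes "finite F"
  shows "formula_of L (diagram F T) \<longleftrightarrow> (\<forall>\<phi>\<in>F. formula_of L \<phi>)"
proof -
  have "formula_of L (foldr (\<lambda>\<phi>. FConj (if \<phi> \<in> T then \<phi> else FNeg \<phi>)) fs (FNeg FBot)) \<longleftrightarrow>
      (\<forall>\<phi>\<in>set fs. formula_of L \<phi>)" for fs
    by (induction fs) auto
  then show ?thesis
    by (simp add: diagram_def set_some_list[OF assms])
qed

lemma qfree_diagram:
  assumes "finite F"
  shows "qfree (diagram F T) \<longleftrightarrow> (\<forall>\<phi>\<in>F. qfree \<phi>)"
proof -
  have "qfree (foldr (\<lambda>\<phi>. FConj (if \<phi> \<in> T then \<phi> else FNeg \<phi>)) fs (FNeg FBot)) \<longleftrightarrow>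
      (\<forall>\<phi>\<in>set fs. qfree \<phi>)" for fs
    by (induction fs) auto
  then show ?thesis
    by (simp add: diagram_def set_some_list[OF assms])
qed

lemmas diagram_simps = sat_diagram fv_diagram formula_of_diagram qfree_diagram

text \<open>By De Morgan, the negation of the diagram that denies every member of
  \<open>F\<close>.\<close>

definition disj :: "'r fm set \<Rightarrow> 'r fm" where
  "disj F = FNeg (diagram F {})"

lemma disj_simps:
  assumes "finite F"
  shows "sat M v (disj F) \<longleftrightarrow> (\<exists>\<phi>\<in>F. sat M v \<phi>)"
    and "fv (disj F) = (\<Union>\<phi>\<in>F. fv \<phi>)"
    and "formula_of L (disj F) \<longleftrightarrow> (\<forall>\<phi>\<in>F. formula_of L \<phi>)"
    and "qfree (disj F) \<longleftrightarrow> (\<forall>\<phi>\<in>F. qfree \<phi>)"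
  using assms by (simp_all add: disj_def diagram_simps)

text \<open>There are finitely many diagrams over \<open>G\<close>, and each valuation satisfies the
  one recording its own truth values. By \<open>det\<close>, a diagram realised together with
  \<open>\<phi>\<close> implies \<open>\<phi>\<close>, so the disjunction of these diagrams is as
  required.\<close>

lemma qfree_equiv_if_determined:
  assumes fin: "finite G"
    and G: "\<And>\<gamma>. \<gamma> \<in> G \<Longrightarrow> formula_of L \<gamma> \<and> qfree \<gamma> \<and> fv \<gamma> \<subseteq> V"
    and det: "\<And>v w. range v \<subseteq> base M \<Longrightarrow> range w \<subseteq> base M \<Longrightarrow>
      (\<And>\<gamma>. \<gamma> \<in> G \<Longrightarrow> sat M v \<gamma> \<longleftrightarrow> sat M w \<gamma>) \<Longrightarrow> sat M v \<phi> \<longleftrightarrow> sat M w \<phi>"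
  shows "\<exists>\<psi>. formula_of L \<psi> \<and> qfree \<psi> \<and> fv \<psi> \<subseteq> V \<and> equiv_in M \<phi> \<psi>"
proof -
  define S where "S = {diagram G T | T. T \<subseteq> G \<and>
    (\<exists>v. range v \<subseteq> base M \<and> sat M v (diagram G T) \<and> sat M v \<phi>)}"
  have "S \<subseteq> diagram G ` Pow G"
    unfolding S_def by blast
  then have finS: "finite S"
    using fin by (meson finite_Pow_iff finite_imageI finite_subset)
  have "sat M v \<phi> \<longleftrightarrow> sat M v (disj S)" if v: "range v \<subseteq> base M" for v
  proof
    assume "sat M v \<phi>"
    then have "diagram G {\<gamma> \<in> G. sat M v \<gamma>} \<in> S"
      unfolding S_def using v fin by (auto simp: sat_diagram)
    moreover have "sat M v (diagram G {\<gamma> \<in> G. sat M v \<gamma>})"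
      using fin by (simp add: sat_diagram)
    ultimately show "sat M v (disj S)"
      using finS by (auto simp: disj_simps)
  next
    assume "sat M v (disj S)"
    then obtain T w where "sat M v (diagram G T)" "range w \<subseteq> base M" "sat M w (diagram G T)"
      "sat M w \<phi>"
      using finS unfolding S_def by (auto simp: disj_simps)
    then show "sat M v \<phi>"
      using det[OF v, of w] fin by (simp add: sat_diagram)
  qed
  then have "equiv_in M \<phi> (disj S)"
    by (simp add: equiv_in_def)
  moreover have "formula_of L (disj S)" "qfree (disj S)" "fv (disj S) \<subseteq> V"
    using finS fin G by (fastforce simp: disj_simps S_def diagram_simps)+
  ultimately show ?thesis by blast
qed

section \<open>Sentences and equivalence of formulas\<close>

text \<open>No variable is read, so \<open>v\<close> may even leave the base; a nonempty base keeps
  \<open>holds\<close> from being vacuous.\<close>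

lemma sat_sentence:
  assumes "fv \<phi> = {}" "base M \<noteq> {}"
  shows "holds M \<phi> \<longleftrightarrow> sat M v \<phi>"
proof -
  obtain a where "a \<in> base M" using assms(2) by blast
  then have "range (\<lambda>_::nat. a) \<subseteq> base M" by auto
  moreover have "sat M w \<phi> \<longleftrightarrow> sat M v \<phi>" for w
    by (rule sat_cong) (simp add: assms(1))
  ultimately show ?thesis unfolding holds_def by blast
qed

text \<open>\<open>equiv_in\<close> speaks only of valuations with all values in the base, so
  variables that are not free are first sent to a fixed element. This serves
  \<open>snd \<circ> v\<close>, which may leave a given fibre outside the free variables.\<close>

lemma sat_eq_if_equiv_in:
  assumes "equiv_in M \<phi> \<psi>" "base M \<noteq> {}" "\<And>x. x \<in> fv \<phi> \<union> fv \<psi> \<Longrightarrow> v x \<in> base M"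
  shows "sat M v \<phi> \<longleftrightarrow> sat M v \<psi>"
proof -
  obtain a where a: "a \<in> base M" using assms(2) by blast
  let ?w = "\<lambda>x. if x \<in> fv \<phi> \<union> fv \<psi> then v x else a"
  have "range ?w \<subseteq> base M"
    using a assms(3) by auto
  then have "sat M ?w \<phi> \<longleftrightarrow> sat M ?w \<psi>"
    using assms(1) unfolding equiv_in_def by blast
  moreover have "sat M ?w \<phi> \<longleftrightarrow> sat M v \<phi>" "sat M ?w \<psi> \<longleftrightarrow> sat M v \<psi>"
    by (rule sat_cong; simp)+
  ultimately show ?thesis by simp
qed

lemma sat_foldr_FEx:
  "sat M v (foldr FEx xs \<phi>) \<longleftrightarrow>
     (\<exists>w. (\<forall>x. x \<notin> set xs \<longrightarrow> w x = v x) \<and> (\<forall>x\<in>set xs. w x \<in> base M) \<and> sat M w \<phi>)"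
proof (induction xs arbitrary: v)
  case Nil
  have "(\<forall>x. w x = v x) \<longleftrightarrow> w = v" for w by auto
  then show ?case by simp
next
  case (Cons y ys)
  show ?case
  proof
    assume "sat M v (foldr FEx (y # ys) \<phi>)"
    then obtain a w where a: "a \<in> base M" and w: "\<forall>x. x \<notin> set ys \<longrightarrow> w x = (v(y := a)) x"
      "\<forall>x\<in>set ys. w x \<in> base M" "sat M w \<phi>"
      by (auto simp: Cons.IH)
    \<comment> \<open>\<open>y\<close> may recur in \<open>ys\<close>, and then \<open>w y\<close>
      is the inner choice rather than \<open>a\<close>.\<close>
    have "w y \<in> base M"
      using a w(1,2) by (cases "y \<in> set ys") auto
    then show "\<exists>w. (\<forall>x. x \<notin> set (y # ys) \<longrightarrow> w x = v x) \<and>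
        (\<forall>x\<in>set (y # ys). w x \<in> base M) \<and> sat M w \<phi>"
      using w by (intro exI[of _ w]) auto
  next
    assume "\<exists>w. (\<forall>x. x \<notin> set (y # ys) \<longrightarrow> w x = v x) \<and>
        (\<forall>x\<in>set (y # ys). w x \<in> base M) \<and> sat M w \<phi>"
    then obtain w where w: "\<forall>x. x \<notin> set (y # ys) \<longrightarrow> w x = v x"
        "\<forall>x\<in>set (y # ys). w x \<in> base M" "sat M w \<phi>"
      by blast
    then have "sat M (v(y := w y)) (foldr FEx ys \<phi>)"
      unfolding Cons.IH by (intro exI[of _ w]) auto
    then show "sat M v (foldr FEx (y # ys) \<phi>)"
      using w(2) by auto
  qed
qed

lemma fv_foldr_FEx: "fv (foldr FEx xs \<phi>) = fv \<phi> - set xs"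
  by (induction xs) auto

lemma formula_of_foldr_FEx: "formula_of L (foldr FEx xs \<phi>) \<longleftrightarrow> formula_of L \<phi>"
  by (induction xs) auto

text \<open>The sentence is the negated existential closure of \<open>\<delta>\<close>, which says
  that exactly one of the two formulas holds. It is fixed before the structure, so that one sentence
  serves all fibres.\<close>

lemma equivalence_sentence:
  assumes "formula_of L \<phi>" "formula_of L \<psi>"
  obtains \<sigma> where "sentence_of L \<sigma>"
    and "\<And>M :: ('r, 'a) fo_struct. base M \<noteq> {} \<Longrightarrow> holds M \<sigma> \<longleftrightarrow> equiv_in M \<phi> \<psi>"
proof -
  define \<delta> where "\<delta> = FConj (FNeg (FConj \<phi> \<psi>)) (FNeg (FConj (FNeg \<phi>) (FNeg \<psi>)))"
  obtain xs where xs: "set xs = fv \<delta>"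
    using finite_fv finite_list by blast
  define \<sigma> where "\<sigma> = FNeg (foldr FEx xs \<delta>)"
  have \<sigma>: "sentence_of L \<sigma>"
    using assms
    by (simp add: sentence_of_def \<sigma>_def formula_of_foldr_FEx fv_foldr_FEx xs) (simp add: \<delta>_def)
  have "holds M \<sigma> \<longleftrightarrow> equiv_in M \<phi> \<psi>" if "base M \<noteq> {}" for M :: "('r, 'a) fo_struct"
  proof -
    obtain a where a: "a \<in> base M" using \<open>base M \<noteq> {}\<close> by blast
    have "holds M \<sigma> \<longleftrightarrow> \<not> (\<exists>w. (\<forall>x. x \<notin> fv \<delta> \<longrightarrow> w x = a) \<and> (\<forall>x\<in>fv \<delta>. w x \<in> base M) \<and> sat M w \<delta>)"
      using sat_sentence[of \<sigma> M "\<lambda>_. a"] \<sigma> that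
      by (simp add: sentence_of_def \<sigma>_def sat_foldr_FEx xs)
    also have "\<dots> \<longleftrightarrow> \<not> (\<exists>w. range w \<subseteq> base M \<and> sat M w \<delta>)"
    proof -
      have "\<exists>w. (\<forall>x. x \<notin> fv \<delta> \<longrightarrow> w x = a) \<and> (\<forall>x\<in>fv \<delta>. w x \<in> base M) \<and> sat M w \<delta>"
        if "range w \<subseteq> base M" "sat M w \<delta>" for w
      proof -
        \<comment> \<open>The closure is evaluated at the constant valuation \<open>a\<close>, hence
          the reset off the free variables.\<close>
        let ?w = "\<lambda>x. if x \<in> fv \<delta> then w x else a"
        have "sat M ?w \<delta> \<longleftrightarrow> sat M w \<delta>"
          by (rule sat_cong) simp
        then show ?thesis
          using that by (intro exI[of _ ?w]) auto
      qed
      moreover have "range w \<subseteq> base M"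
        if "\<forall>x. x \<notin> fv \<delta> \<longrightarrow> w x = a" "\<forall>x\<in>fv \<delta>. w x \<in> base M" for w
        using that a by (metis image_subset_iff)
      ultimately show ?thesis by blast
    qed
    also have "\<dots> \<longleftrightarrow> equiv_in M \<phi> \<psi>"
      by (auto simp: \<delta>_def equiv_in_def)
    finally show ?thesis .
  qed
  with \<sigma> show thesis by (rule that)
qed

section \<open>Transport of structures along an injection\<close>

text \<open>For injective \<open>f\<close> this is an isomorphic copy of \<open>K\<close>. Uniform
  elimination is assumed for models in one type \<open>'c\<close>, whereas the fibres live in
  \<open>'b\<close>; the copy bridges the two.\<close>

definition map_struct :: "('a \<Rightarrow> 'c) \<Rightarrow> ('r, 'a) fo_struct \<Rightarrow> ('r, 'c) fo_struct" where
  "map_struct f K = \<lparr>base = f ` base K, interp = (\<lambda>R. map f ` interp K R)\<rparr>"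

lemma base_map_struct: "base (map_struct f K) = f ` base K"
  by (simp add: map_struct_def)

lemma sat_map_struct:
  assumes "inj f"
  shows "sat (map_struct f K) (f \<circ> v) \<phi> \<longleftrightarrow> sat K v \<phi>"
proof (induction \<phi> arbitrary: v)
  case (FEq x y)
  then show ?case using assms by (simp add: inj_eq)
next
  case (FRel R xs)
  have "map (f \<circ> v) xs = map f (map v xs)" by simp
  then show ?case
    using assms by (simp only: sat.simps map_struct_def fo_struct.simps inj_image_mem_iff inj_mapI)
next
  case (FEx x \<phi>)
  have *: "(f \<circ> v)(x := f a) = f \<circ> v(x := a)" for a by auto
  have "sat (map_struct f K) ((f \<circ> v)(x := f a)) \<phi> \<longleftrightarrow> sat K (v(x := a)) \<phi>" for a
    unfolding * by (rule FEx.IH)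
  then show ?case
    by (simp add: base_map_struct del: comp_apply)
qed (auto simp: map_struct_def)

lemma ex_valuation_map_struct:
  fixes w :: "nat \<Rightarrow> 'c"
  assumes "range w \<subseteq> base (map_struct f K)"
  obtains v where "w = f \<circ> v" "range v \<subseteq> base K"
proof -
  have "\<forall>x. \<exists>a. w x = f a \<and> a \<in> base K"
    using assms by (auto simp: map_struct_def)
  then obtain v where "\<And>x. w x = f (v x) \<and> v x \<in> base K" by metis
  then show thesis by (intro that[of v]) auto
qed

lemma range_map_struct: "range v \<subseteq> base K \<Longrightarrow> range (f \<circ> v) \<subseteq> base (map_struct f K)"
  by (auto simp: map_struct_def)

lemma holds_map_struct:
  fixes f :: "'a \<Rightarrow> 'c"
  assumes "inj f"
  shows "holds (map_struct f K) \<phi> \<longleftrightarrow> holds K \<phi>"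
  unfolding holds_def
proof (intro iffI allI impI)
  fix v :: "nat \<Rightarrow> 'a"
  assume "\<forall>w. range w \<subseteq> base (map_struct f K) \<longrightarrow> sat (map_struct f K) w \<phi>" "range v \<subseteq> base K"
  then show "sat K v \<phi>"
    using sat_map_struct[OF assms, of K v] range_map_struct[of v K f] by metis
next
  fix w :: "nat \<Rightarrow> 'c"
  assume *: "\<forall>v. range v \<subseteq> base K \<longrightarrow> sat K v \<phi>" and "range w \<subseteq> base (map_struct f K)"
  then obtain v where "w = f \<circ> v" "range v \<subseteq> base K"
    by (elim ex_valuation_map_struct)
  with * show "sat (map_struct f K) w \<phi>"
    by (simp add: sat_map_struct[OF assms] del: comp_apply)
qed

text \<open>Turns an equivalence into the truth of a single formula, so that its transport follows
  from \<open>holds_map_struct\<close>. Free variables are quantified universally by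
  \<open>holds\<close>.\<close>

lemma equiv_in_iff_holds:
  "equiv_in M \<phi> \<psi> \<longleftrightarrow>
     holds M (FConj (FNeg (FConj \<phi> (FNeg \<psi>))) (FNeg (FConj (FNeg \<phi>) \<psi>)))"
  by (auto simp: equiv_in_def holds_def)

lemma equiv_in_map_struct:
  assumes "inj f"
  shows "equiv_in (map_struct f K) \<phi> \<psi> \<longleftrightarrow> equiv_in K \<phi> \<psi>"
  by (simp only: equiv_in_iff_holds holds_map_struct[OF assms])

lemma structure_of_map_struct:
  assumes "structure_of L K"
  shows "structure_of L (map_struct f K)"
  unfolding structure_of_def
proof (intro conjI allI impI)
  show "base (map_struct f K) \<noteq> {}"
    using assms by (simp add: structure_of_def base_map_struct)
next
  fix R n assume "L R = Some n"
  then have "interp K R \<subseteq> {as. length as = n \<and> set as \<subseteq> base K}"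
    using assms by (simp add: structure_of_def)
  then show "interp (map_struct f K) R \<subseteq> {as. length as = n \<and> set as \<subseteq> base (map_struct f K)}"
    by (fastforce simp: map_struct_def)
qed

text \<open>Each fibre satisfies the common theory, hence so does its copy in \<open>'c\<close>;
  there the hypothesis selects an index, and the equivalence is pulled back along \<open>f\<close>.
  The family \<open>\<Phi>\<close> does not depend on the fibre.\<close>

lemma uniform_QE_members:
  fixes N :: "'a \<Rightarrow> ('r, 'b) fo_struct" and f :: "'b \<Rightarrow> 'c"
  assumes QE: "uniform_QE TYPE('c) L (common_theory L M N)" and f: "inj f"
    and N: "\<And>a. a \<in> base M \<Longrightarrow> structure_of L (N a)" and \<phi>: "formula_of L \<phi>"
  obtains k :: nat and \<Phi> where
    "\<And>i. i < k \<Longrightarrow> formula_of L (\<Phi> i) \<and> qfree (\<Phi> i) \<and> fv (\<Phi> i) \<subseteq> fv \<phi>"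
    "\<And>a. a \<in> base M \<Longrightarrow> \<exists>i<k. equiv_in (N a) \<phi> (\<Phi> i)"
proof -
  obtain k :: nat and \<Phi> where
    1: "\<forall>i<k. formula_of L (\<Phi> i) \<and> qfree (\<Phi> i) \<and> fv (\<Phi> i) \<subseteq> fv \<phi>" and
    2: "\<forall>K :: ('r, 'c) fo_struct. model_of L (common_theory L M N) K \<longrightarrow>
      (\<exists>i<k. equiv_in K \<phi> (\<Phi> i))"
    using QE \<phi> unfolding uniform_QE_def by blast
  have "\<exists>i<k. equiv_in (N a) \<phi> (\<Phi> i)" if a: "a \<in> base M" for a
  proof -
    have "model_of L (common_theory L M N) (map_struct f (N a))"
      using a by (simp add: model_of_def structure_of_map_struct N holds_map_struct f common_theory_def)
    then obtain i where "i < k" "equiv_in (map_struct f (N a)) \<phi> (\<Phi> i)"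
      using 2 by blast
    then show ?thesis
      using equiv_in_map_struct[OF f] by blast
  qed
  with 1 show thesis by (intro that[of k \<Phi>]) auto
qed

section \<open>The product and its atomic formulas\<close>

locale lex_product_setting =
  fixes L :: "'r lang"
    and M :: "('r, 'a) fo_struct"
    and N :: "'a \<Rightarrow> ('r, 'b) fo_struct"
  assumes M: "structure_of L M"
    and N: "\<And>a. a \<in> base M \<Longrightarrow> structure_of L (N a)"
    and definable: "\<And>\<phi>. sentence_of L \<phi> \<Longrightarrow> zero_definable L M {a \<in> base M. holds (N a) \<phi>}"
begin

abbreviation P where "P \<equiv> lex_product L M N"

lemma base_N: "a \<in> base M \<Longrightarrow> base (N a) \<noteq> {}"
  using N by (auto simp: structure_of_def)

lemma base_P: "base P = (SIGMA a : base M. base (N a))"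
  by (simp add: lex_product_def)

lemma
  assumes "range v \<subseteq> base P"
  shows fst_base: "fst (v x) \<in> base M" and snd_base: "snd (v x) \<in> base (N (fst (v x)))"
proof -
  have "v x \<in> base P" using assms by blast
  then show "fst (v x) \<in> base M" "snd (v x) \<in> base (N (fst (v x)))"
    by (auto simp: base_P)
qed

text \<open>A tuple within one fibre can only enter through the first part of
  \<open>lex_interp\<close>, as the second demands two different first coordinates. The occurrence
  of \<open>y\<close> in \<open>xs\<close> excludes the empty tuple, which does not reveal its
  fibre.\<close>

lemma sat_Orig_const:
  assumes v: "range v \<subseteq> base P" and R: "L R = Some (length xs)" and y: "y \<in> set xs"
    and eq: "\<And>x. x \<in> set xs \<Longrightarrow> fst (v x) = fst (v y)"
  shows "sat P v (FRel (Orig R) xs) \<longleftrightarrow> sat (N (fst (v y))) (snd \<circ> v) (FRel R xs)"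
proof -
  let ?a = "fst (v y)"
  have *: "map v xs = map (Pair ?a) (map (snd \<circ> v) xs)"
    using eq by (auto simp: prod_eq_iff)
  have "map v xs \<in> lex_interp L M N (Orig R) \<longleftrightarrow>
      (\<exists>a bs. map v xs = map (Pair a) bs \<and> a \<in> base M \<and> bs \<in> interp (N a) R)"
    using eq by (auto simp: nth_mem)
  also have "\<dots> \<longleftrightarrow> map (snd \<circ> v) xs \<in> interp (N ?a) R"
  proof
    assume "\<exists>a bs. map v xs = map (Pair a) bs \<and> a \<in> base M \<and> bs \<in> interp (N a) R"
    then obtain a bs where ab: "map v xs = map (Pair a) bs" "bs \<in> interp (N a) R" by blast
    have "v y \<in> set (map (Pair a) bs)"
      unfolding ab(1)[symmetric] using y by simp
    then have "a = ?a" by auto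
    moreover have "map snd (map v xs) = bs"
      by (simp add: ab(1) comp_def)
    ultimately show "map (snd \<circ> v) xs \<in> interp (N ?a) R"
      using ab(2) by simp
  next
    assume "map (snd \<circ> v) xs \<in> interp (N ?a) R"
    then show "\<exists>a bs. map v xs = map (Pair a) bs \<and> a \<in> base M \<and> bs \<in> interp (N a) R"
      using * fst_base[OF v] by blast
  qed
  finally show ?thesis by (simp add: lex_product_def del: lex_interp.simps)
qed

text \<open>Two different first coordinates rule out the fibre part of \<open>lex_interp\<close>,
  leaving the part read in \<open>M\<close>.\<close>

lemma sat_Orig_nonconst:
  assumes v: "range v \<subseteq> base P" and xy: "x \<in> set xs" "y \<in> set xs" "fst (v x) \<noteq> fst (v y)"
  shows "sat P v (FRel (Orig R) xs) \<longleftrightarrow> sat M (fst \<circ> v) (FRel R xs)"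
proof -
  have no: "map v xs \<noteq> map (Pair a) bs" for a bs
  proof
    assume eq: "map v xs = map (Pair a) bs"
    have "v x \<in> set (map (Pair a) bs)" "v y \<in> set (map (Pair a) bs)"
      unfolding eq[symmetric] using xy by simp_all
    then show False using xy(3) by auto
  qed
  obtain i j where ij: "i < length xs" "j < length xs" "xs ! i = x" "xs ! j = y"
    using xy by (meson in_set_conv_nth)
  then have "i \<noteq> j" using xy by auto
  \<comment> \<open>The inequality of coordinates is symmetric, so the two positions may be put in
    increasing order.\<close>
  then have ex: "\<exists>i j. i < j \<and> j < length (map v xs) \<and> fst (map v xs ! i) \<noteq> fst (map v xs ! j)"
    using ij xy(3) by (metis length_map linorder_neqE_nat nth_map)
  have "set (map v xs) \<subseteq> base P"
    using v by auto
  then show ?thesis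
    using no ex by (simp add: lex_product_def)
qed

lemma sat_Unary:
  assumes "range v \<subseteq> base P" "L R = Some n"
  shows "sat P v (FRel (Unary R) [x]) \<longleftrightarrow> replicate n (fst (v x)) \<in> interp M R"
  using assms fst_base[OF assms(1), of x] snd_base[OF assms(1), of x]
  by (cases "v x") (auto simp: lex_product_def)

lemma sat_Same:
  assumes "range v \<subseteq> base P"
  shows "sat P v (FRel Same [x, y]) \<longleftrightarrow> fst (v x) = fst (v y)"
  using fst_base[OF assms, of x] snd_base[OF assms, of x] snd_base[OF assms, of y]
  by (cases "v x"; cases "v y") (auto simp: lex_product_def)

text \<open>Definability supplies a formula in some variable \<open>x\<close> of its own. The
  formula \<open>FEx x (FConj (FEq x z) \<psi>)\<close> moves it to \<open>z\<close> without a
  substitution operation.\<close>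

lemma ex_definable_at:
  assumes "sentence_of L \<phi>"
  obtains \<psi> where "formula_of L \<psi>" "fv \<psi> \<subseteq> {z}"
    "\<And>w. w z \<in> base M \<Longrightarrow> sat M w \<psi> \<longleftrightarrow> holds (N (w z)) \<phi>"
proof -
  obtain \<psi> x where \<psi>: "formula_of L \<psi>" "fv \<psi> \<subseteq> {x}"
    "{a \<in> base M. holds (N a) \<phi>} = {a \<in> base M. sat M (\<lambda>_. a) \<psi>}"
    using definable[OF assms] unfolding zero_definable_def by blast
  have *: "sat M w \<psi> \<longleftrightarrow> holds (N (w x)) \<phi>" if "w x \<in> base M" for w
  proof -
    have "sat M w \<psi> \<longleftrightarrow> sat M (\<lambda>_. w x) \<psi>"
      by (rule sat_cong) (use \<psi>(2) in auto)
    then show ?thesis using \<psi>(3) that by blast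
  qed
  show thesis
  proof (cases "x = z")
    case True
    with \<psi> * show thesis by (intro that[of \<psi>]) auto
  next
    case False
    show thesis
    proof (rule that[of "FEx x (FConj (FEq x z) \<psi>)"])
      show "sat M w (FEx x (FConj (FEq x z) \<psi>)) \<longleftrightarrow> holds (N (w z)) \<phi>" if "w z \<in> base M" for w
        using False that *[of "w(x := w z)"] by auto
    qed (use \<psi> in auto)
  qed
qed

section \<open>Agreement of valuations and the back-and-forth step\<close>

text \<open>In the third clause \<open>y\<close> merely names a fibre and need not occur in
  \<open>\<chi>\<close>; a closed \<open>\<chi>\<close> is thus compared in the fibre of every
  \<open>y \<in> V\<close>. The guard restricts \<open>\<chi>\<close> to points of that fibre, where
  alone its truth makes sense.\<close>

definition agree ::
  "nat set \<Rightarrow> 'r fm set \<Rightarrow> 'r fm set \<Rightarrow> (nat \<Rightarrow> 'a \<times> 'b) \<Rightarrow> (nat \<Rightarrow> 'a \<times> 'b) \<Rightarrow> bool" where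
  "agree V \<Theta> X v w \<longleftrightarrow>
     (\<forall>x\<in>V. \<forall>y\<in>V. fst (v x) = fst (v y) \<longleftrightarrow> fst (w x) = fst (w y)) \<and>
     (\<forall>\<theta>\<in>\<Theta>. sat M (fst \<circ> v) \<theta> \<longleftrightarrow> sat M (fst \<circ> w) \<theta>) \<and>
     (\<forall>y\<in>V. \<forall>\<chi>\<in>X. (\<forall>x\<in>fv \<chi>. fst (v x) = fst (v y)) \<longrightarrow>
        (sat (N (fst (v y))) (snd \<circ> v) \<chi> \<longleftrightarrow> sat (N (fst (w y))) (snd \<circ> w) \<chi>))"

lemma agreeD:
  assumes "agree V \<Theta> X v w"
  shows "x \<in> V \<Longrightarrow> y \<in> V \<Longrightarrow> fst (v x) = fst (v y) \<longleftrightarrow> fst (w x) = fst (w y)"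
    and "\<theta> \<in> \<Theta> \<Longrightarrow> sat M (fst \<circ> v) \<theta> \<longleftrightarrow> sat M (fst \<circ> w) \<theta>"
    and "y \<in> V \<Longrightarrow> \<chi> \<in> X \<Longrightarrow> (\<And>x. x \<in> fv \<chi> \<Longrightarrow> fst (v x) = fst (v y)) \<Longrightarrow>
      sat (N (fst (v y))) (snd \<circ> v) \<chi> \<longleftrightarrow> sat (N (fst (w y))) (snd \<circ> w) \<chi>"
  using assms unfolding agree_def by simp_all

lemma agreeI:
  assumes "\<And>x y. x \<in> V \<Longrightarrow> y \<in> V \<Longrightarrow> fst (v x) = fst (v y) \<longleftrightarrow> fst (w x) = fst (w y)"
    and "\<And>\<theta>. \<theta> \<in> \<Theta> \<Longrightarrow> sat M (fst \<circ> v) \<theta> \<longleftrightarrow> sat M (fst \<circ> w) \<theta>"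
    and "\<And>y \<chi>. y \<in> V \<Longrightarrow> \<chi> \<in> X \<Longrightarrow> (\<And>x. x \<in> fv \<chi> \<Longrightarrow> fst (v x) = fst (v y)) \<Longrightarrow>
      sat (N (fst (v y))) (snd \<circ> v) \<chi> \<longleftrightarrow> sat (N (fst (w y))) (snd \<circ> w) \<chi>"
  shows "agree V \<Theta> X v w"
  unfolding agree_def using assms by simp

lemma agree_mono:
  assumes "agree V \<Theta> X v w" "V' \<subseteq> V" "\<Theta>' \<subseteq> \<Theta>" "X' \<subseteq> X"
  shows "agree V' \<Theta>' X' v w"
proof (rule agreeI)
  show "fst (v x) = fst (v y) \<longleftrightarrow> fst (w x) = fst (w y)" if "x \<in> V'" "y \<in> V'" for x y
    using agreeD(1)[OF assms(1)] assms(2) that by (meson subsetD)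
  show "sat M (fst \<circ> v) \<theta> \<longleftrightarrow> sat M (fst \<circ> w) \<theta>" if "\<theta> \<in> \<Theta>'" for \<theta>
    using agreeD(2)[OF assms(1), of \<theta>] assms(3) that by auto
  show "sat (N (fst (v y))) (snd \<circ> v) \<chi> \<longleftrightarrow> sat (N (fst (w y))) (snd \<circ> w) \<chi>"
    if "y \<in> V'" "\<chi> \<in> X'" "\<And>x. x \<in> fv \<chi> \<Longrightarrow> fst (v x) = fst (v y)" for y \<chi>
    by (rule agreeD(3)[OF assms(1)]) (use assms(2,4) that in auto)
qed

definition fms_in :: "nat set \<Rightarrow> 'r fm set \<Rightarrow> bool" where
  "fms_in V F \<longleftrightarrow> finite F \<and> (\<forall>\<phi>\<in>F. formula_of L \<phi> \<and> fv \<phi> \<subseteq> V)"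

lemma fms_in_mono: "fms_in V F \<Longrightarrow> V \<subseteq> V' \<Longrightarrow> fms_in V' F"
  unfolding fms_in_def by blast

text \<open>A fibre other than that of \<open>p\<close> sees nothing new: a \<open>\<chi>\<close>
  whose free variables all lie in it cannot contain \<open>z\<close>, so the old agreement applies.
  Only the fibre of \<open>p\<close> needs the premise \<open>X\<close>.\<close>

lemma agree_extend:
  assumes vw: "agree V \<Theta>' X' v w" and z: "z \<notin> V" and X': "{\<chi> \<in> X. z \<notin> fv \<chi>} \<subseteq> X'"
    and cls: "\<And>x. x \<in> V \<Longrightarrow> fst (v x) = fst p \<longleftrightarrow> fst (w x) = fst q"
    and \<Theta>: "\<And>\<theta>. \<theta> \<in> \<Theta> \<Longrightarrow> sat M (fst \<circ> v(z := p)) \<theta> \<longleftrightarrow> sat M (fst \<circ> w(z := q)) \<theta>"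
    and X: "\<And>\<chi>. \<chi> \<in> X \<Longrightarrow> (\<And>x. x \<in> fv \<chi> \<Longrightarrow> x = z \<or> fst (v x) = fst p) \<Longrightarrow>
      sat (N (fst p)) (snd \<circ> v(z := p)) \<chi> \<longleftrightarrow> sat (N (fst q)) (snd \<circ> w(z := q)) \<chi>"
  shows "agree (insert z V) \<Theta> X (v(z := p)) (w(z := q))"
proof (rule agreeI)
  fix x y assume "x \<in> insert z V" "y \<in> insert z V"
  then show "fst ((v(z := p)) x) = fst ((v(z := p)) y) \<longleftrightarrow> fst ((w(z := q)) x) = fst ((w(z := q)) y)"
    using agreeD(1)[OF vw, of x y] cls[of x] cls[of y]
    by (cases "x = z"; cases "y = z") (auto simp: eq_commute)
next
  fix y \<chi>
  assume y: "y \<in> insert z V" and \<chi>: "\<chi> \<in> X"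
    and eq: "\<And>x. x \<in> fv \<chi> \<Longrightarrow> fst ((v(z := p)) x) = fst ((v(z := p)) y)"
  show "sat (N (fst ((v(z := p)) y))) (snd \<circ> v(z := p)) \<chi> \<longleftrightarrow>
      sat (N (fst ((w(z := q)) y))) (snd \<circ> w(z := q)) \<chi>"
  proof (cases "fst ((v(z := p)) y) = fst p")
    case True
    have "fst ((w(z := q)) y) = fst q"
      using True cls[of y] y by (cases "y = z") auto
    moreover have "x = z \<or> fst (v x) = fst p" if "x \<in> fv \<chi>" for x
      using eq[OF that] True by (cases "x = z") auto
    ultimately show ?thesis
      using X[OF \<chi>] True by metis
  next
    case False
    then have yz: "y \<noteq> z" by auto
    have zn: "z \<notin> fv \<chi>"
      using eq[of z] False by auto
    have eq': "fst (v x) = fst (v y)" if "x \<in> fv \<chi>" for x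
      using eq[OF that] yz zn that by (cases "x = z") auto
    have "sat K (snd \<circ> u(z := r)) \<chi> \<longleftrightarrow> sat K (snd \<circ> u) \<chi>" for K r and u :: "nat \<Rightarrow> 'a \<times> 'b"
      by (rule sat_cong) (use zn in auto)
    moreover have "sat (N (fst (v y))) (snd \<circ> v) \<chi> \<longleftrightarrow> sat (N (fst (w y))) (snd \<circ> w) \<chi>"
      by (rule agreeD(3)[OF vw]) (use y yz X' \<chi> zn eq' in auto)
    ultimately show ?thesis
      using yz by simp
  qed
qed (rule \<Theta>)

text \<open>
  The new point \<open>p\<close> either lies in the fibre of one of the points already played, or its first
  coordinate is new. In the latter case \<open>M\<close> has to know which parameter-free types are realised in
  the new fibre, which it does by \<open>definable\<close>.
\<close>

lemma agree_forth:
  assumes V: "finite V" and z: "z \<notin> V"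
    and \<Theta>: "fms_in (insert z V) \<Theta>" and X: "fms_in (insert z V) X"
  obtains \<Theta>' X' where "fms_in V \<Theta>'" "fms_in V X'"
    "\<And>v w p. range v \<subseteq> base P \<Longrightarrow> range w \<subseteq> base P \<Longrightarrow> agree V \<Theta>' X' v w \<Longrightarrow> p \<in> base P \<Longrightarrow>
       \<exists>q\<in>base P. agree (insert z V) \<Theta> X (v(z := p)) (w(z := q))"
proof -
  \<comment> \<open>\<open>rlz F T\<close> says that the type \<open>T\<close> over \<open>F\<close>
    is realised by a value of \<open>z\<close>. \<open>X\<^sub>0\<close> holds the formulas that can
    be read in a fibre containing no earlier point.\<close>
  define rlz where "rlz F T = FEx z (diagram F T)" for F T :: "'r fm set"
  define X\<^sub>0 where "X\<^sub>0 = {\<chi> \<in> X. fv \<chi> \<subseteq> {z}}"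
  have fin: "finite \<Theta>" "finite X" "finite X\<^sub>0"
    and X_fm: "\<And>\<chi>. \<chi> \<in> X \<Longrightarrow> formula_of L \<chi>" "\<And>\<chi>. \<chi> \<in> X \<Longrightarrow> fv \<chi> \<subseteq> insert z V"
    and \<Theta>_fm: "\<And>\<theta>. \<theta> \<in> \<Theta> \<Longrightarrow> formula_of L \<theta>" "\<And>\<theta>. \<theta> \<in> \<Theta> \<Longrightarrow> fv \<theta> \<subseteq> insert z V"
    using \<Theta> X by (auto simp: fms_in_def X\<^sub>0_def)
  have sat_rlz: "sat K u (rlz F T) \<longleftrightarrow> (\<exists>b\<in>base K. \<forall>\<chi>\<in>F. sat K (u(z := b)) \<chi> \<longleftrightarrow> \<chi> \<in> T)"
    if "F \<subseteq> X" for F T u and K :: "('r, 'b) fo_struct"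
    using finite_subset[OF that fin(2)] by (simp add: rlz_def sat_diagram)
  have fv_rlz: "fv (rlz F T) = (\<Union>\<chi>\<in>F. fv \<chi>) - {z}" and fm_rlz: "formula_of L (rlz F T)"
    if "F \<subseteq> X" for F T
    using finite_subset[OF that fin(2)] X_fm(1) that by (auto simp: rlz_def diagram_simps)
  have sent: "sentence_of L (rlz X\<^sub>0 U)" for U
    using fv_rlz[of X\<^sub>0 U] fm_rlz[of X\<^sub>0 U] by (auto simp: sentence_of_def X\<^sub>0_def)
  \<comment> \<open>\<open>D U\<close> will define in \<open>M\<close> the coordinates whose fibre
    realises the type \<open>U\<close>.\<close>
  have "\<forall>U. \<exists>\<psi>. formula_of L \<psi> \<and> fv \<psi> \<subseteq> {z} \<and>
      (\<forall>u. u z \<in> base M \<longrightarrow> (sat M u \<psi> \<longleftrightarrow> holds (N (u z)) (rlz X\<^sub>0 U)))"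
    using ex_definable_at[OF sent] by metis
  then obtain D where D: "\<And>U. formula_of L (D U)" "\<And>U. fv (D U) \<subseteq> {z}"
    "\<And>U u. u z \<in> base M \<Longrightarrow> sat M u (D U) \<longleftrightarrow> holds (N (u z)) (rlz X\<^sub>0 U)"
    by metis
  \<comment> \<open>These formulas locate the coordinate of the new point: \<open>at_var\<close>
    equates it with that of an old point \<open>y\<close>, while \<open>new\<close> asks for one
    distinct from all old ones, of type \<open>T\<close> over \<open>\<Theta>\<close> and with a
    fibre realising \<open>U\<close>.\<close>
  define at_var where "at_var y \<theta> = FEx z (FConj (FEq z y) \<theta>)" for y and \<theta> :: "'r fm"
  define new where
    "new T U = FEx z (FConj (diagram \<Theta> T) (FConj (D U) (diagram (FEq z ` V) {})))" for T U
  have sat_new: "sat M u (new T U) \<longleftrightarrow> (\<exists>a\<in>base M. (\<forall>\<theta>\<in>\<Theta>. sat M (u(z := a)) \<theta> \<longleftrightarrow> \<theta> \<in> T) \<and>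
      holds (N a) (rlz X\<^sub>0 U) \<and> (\<forall>y\<in>V. u y \<noteq> a))" for T U u
  proof -
    have "sat M (u(z := a)) (diagram (FEq z ` V) {}) \<longleftrightarrow> (\<forall>y\<in>V. u y \<noteq> a)" for a
      using V z by (auto simp: sat_diagram)
    then show ?thesis
      by (auto simp: new_def sat_diagram fin D(3))
  qed
  define \<Theta>' where
    "\<Theta>' = (\<lambda>(y, \<theta>). at_var y \<theta>) ` (V \<times> \<Theta>) \<union> (\<lambda>(T, U). new T U) ` (Pow \<Theta> \<times> Pow X\<^sub>0)"
  \<comment> \<open>Members without \<open>z\<close> serve the fibres that the new point does not
    meet. All subsets \<open>F\<close> are allowed because the formulas that concern its fibre
    depend on the position.\<close>
  define X' where "X' = {\<chi> \<in> X. z \<notin> fv \<chi>} \<union> (\<lambda>(F, T). rlz F T) ` (Pow X \<times> Pow X)"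
  show thesis
  proof (rule that[of \<Theta>' X'])
    have "formula_of L (at_var y \<theta>) \<and> fv (at_var y \<theta>) \<subseteq> V" if "y \<in> V" "\<theta> \<in> \<Theta>" for y \<theta>
      using that \<Theta>_fm[of \<theta>] by (auto simp: at_var_def)
    note at_var_fm = this
    have new_fm: "formula_of L (new T U) \<and> fv (new T U) \<subseteq> V" for T U
      using \<Theta>_fm D(1) D(2)[of U] V by (auto simp: new_def diagram_simps fin)
    have "formula_of L \<theta> \<and> fv \<theta> \<subseteq> V" if "\<theta> \<in> \<Theta>'" for \<theta>
      using that unfolding \<Theta>'_def
      by (elim UnE imageE SigmaE) (use at_var_fm new_fm in simp_all)
    then show "fms_in V \<Theta>'"
      using V fin by (simp add: fms_in_def \<Theta>'_def)
    have "formula_of L (rlz F T) \<and> fv (rlz F T) \<subseteq> V" if "F \<subseteq> X" for F T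
      using fm_rlz[OF that] fv_rlz[OF that] X_fm(2) that by blast
    then have "formula_of L \<chi> \<and> fv \<chi> \<subseteq> V" if "\<chi> \<in> X'" for \<chi>
      using that unfolding X'_def
    proof (elim UnE imageE SigmaE)
      assume "\<chi> \<in> {\<chi> \<in> X. z \<notin> fv \<chi>}"
      then show ?thesis using X_fm[of \<chi>] by auto
    qed (use \<open>\<And>F T. F \<subseteq> X \<Longrightarrow> formula_of L (rlz F T) \<and> fv (rlz F T) \<subseteq> V\<close> in simp)
    then show "fms_in V X'"
      using fin by (simp add: fms_in_def X'_def)
  next
    fix v w p
    assume v: "range v \<subseteq> base P" and w: "range w \<subseteq> base P" and vw: "agree V \<Theta>' X' v w"
      and p: "p \<in> base P"
    have p': "fst p \<in> base M" "snd p \<in> base (N (fst p))"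
      using p by (auto simp: base_P)
    have X': "{\<chi> \<in> X. z \<notin> fv \<chi>} \<subseteq> X'"
      by (auto simp: X'_def)
    show "\<exists>q\<in>base P. agree (insert z V) \<Theta> X (v(z := p)) (w(z := q))"
    proof (cases "\<exists>y\<in>V. fst (v y) = fst p")
      case True
      then obtain y where y: "y \<in> V" "fst (v y) = fst p" by blast
      define F where "F = {\<chi> \<in> X. \<forall>x\<in>fv \<chi>. x = z \<or> fst (v x) = fst p}"
      define T where "T = {\<chi> \<in> F. sat (N (fst p)) (snd \<circ> v(z := p)) \<chi>}"
      have FX: "F \<subseteq> X" "T \<subseteq> X" by (auto simp: F_def T_def)
      have "sat (N (fst p)) (snd \<circ> v) (rlz F T)"
        unfolding sat_rlz[OF FX(1)]
        by (rule bexI[OF _ p'(2)]) (simp add: T_def fun_upd_comp)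
      then have "sat (N (fst (v y))) (snd \<circ> v) (rlz F T)"
        by (simp add: y)
      moreover have "sat (N (fst (v y))) (snd \<circ> v) (rlz F T) \<longleftrightarrow>
          sat (N (fst (w y))) (snd \<circ> w) (rlz F T)"
      proof (rule agreeD(3)[OF vw y(1)])
        show "rlz F T \<in> X'"
          using FX by (auto simp: X'_def)
        show "fst (v x) = fst (v y)" if "x \<in> fv (rlz F T)" for x
          using that fv_rlz[OF FX(1)] y(2) by (auto simp: F_def)
      qed
      ultimately obtain b where b: "b \<in> base (N (fst (w y)))"
        "\<And>\<chi>. \<chi> \<in> F \<Longrightarrow> sat (N (fst (w y))) ((snd \<circ> w)(z := b)) \<chi> \<longleftrightarrow> \<chi> \<in> T"
        unfolding sat_rlz[OF FX(1)] by blast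
      \<comment> \<open>The answer stays in the fibre of \<open>w y\<close>, where \<open>b\<close>
        realises the type of \<open>snd p\<close> relative to the old points of its fibre.\<close>
      let ?q = "(fst (w y), b)"
      have "agree (insert z V) \<Theta> X (v(z := p)) (w(z := ?q))"
      proof (rule agree_extend[OF vw z X'])
        show "fst (v x) = fst p \<longleftrightarrow> fst (w x) = fst ?q" if "x \<in> V" for x
          using agreeD(1)[OF vw that y(1)] y(2) by simp
        show "sat M (fst \<circ> v(z := p)) \<theta> \<longleftrightarrow> sat M (fst \<circ> w(z := ?q)) \<theta>" if "\<theta> \<in> \<Theta>" for \<theta>
        proof -
          have "sat M u (at_var y \<theta>) \<longleftrightarrow> sat M (u(z := u y)) \<theta>" if "u y \<in> base M" for u
            using y(1) z that by (auto simp: at_var_def)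
          moreover have "sat M (fst \<circ> v) (at_var y \<theta>) \<longleftrightarrow> sat M (fst \<circ> w) (at_var y \<theta>)"
            by (rule agreeD(2)[OF vw]) (use that y(1) in \<open>auto simp: \<Theta>'_def\<close>)
          ultimately show ?thesis
            using fst_base[OF v, of y] fst_base[OF w, of y] y(2) by (simp add: fun_upd_comp)
        qed
        show "sat (N (fst p)) (snd \<circ> v(z := p)) \<chi> \<longleftrightarrow> sat (N (fst ?q)) (snd \<circ> w(z := ?q)) \<chi>"
          if "\<chi> \<in> X" "\<And>x. x \<in> fv \<chi> \<Longrightarrow> x = z \<or> fst (v x) = fst p" for \<chi>
        proof -
          have "\<chi> \<in> F" using that by (auto simp: F_def)
          then show ?thesis
            using b(2)[of \<chi>] by (simp add: fun_upd_comp T_def)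
        qed
      qed
      moreover have "?q \<in> base P"
        using b(1) fst_base[OF w] by (simp add: base_P)
      ultimately show ?thesis by blast
    next
      case False
      define T where "T = {\<theta> \<in> \<Theta>. sat M (fst \<circ> v(z := p)) \<theta>}"
      define U where "U = {\<chi> \<in> X\<^sub>0. sat (N (fst p)) (snd \<circ> v(z := p)) \<chi>}"
      have X\<^sub>0X: "X\<^sub>0 \<subseteq> X" by (auto simp: X\<^sub>0_def)
      have holds_rlz: "holds (N a) (rlz X\<^sub>0 U) \<longleftrightarrow>
          (\<exists>b\<in>base (N a). \<forall>\<chi>\<in>X\<^sub>0. sat (N a) (u(z := b)) \<chi> \<longleftrightarrow> \<chi> \<in> U)" if "a \<in> base M" for a u
        unfolding sat_rlz[OF X\<^sub>0X, symmetric]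
        by (rule sat_sentence) (use sent base_N[OF that] in \<open>auto simp: sentence_of_def\<close>)
      have "holds (N (fst p)) (rlz X\<^sub>0 U)"
        unfolding holds_rlz[OF p'(1), of "snd \<circ> v"]
        by (rule bexI[OF _ p'(2)]) (simp add: U_def fun_upd_comp)
      then have "sat M (fst \<circ> v) (new T U)"
        unfolding sat_new using False
        by (intro bexI[OF _ p'(1)]) (simp add: T_def fun_upd_comp)
      moreover have "sat M (fst \<circ> v) (new T U) \<longleftrightarrow> sat M (fst \<circ> w) (new T U)"
        by (rule agreeD(2)[OF vw]) (auto simp: \<Theta>'_def T_def U_def)
      ultimately have "sat M (fst \<circ> w) (new T U)" by blast
      then obtain a where a: "a \<in> base M"
        "\<And>\<theta>. \<theta> \<in> \<Theta> \<Longrightarrow> sat M ((fst \<circ> w)(z := a)) \<theta> \<longleftrightarrow> \<theta> \<in> T"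
        "holds (N a) (rlz X\<^sub>0 U)" "\<And>y. y \<in> V \<Longrightarrow> fst (w y) \<noteq> a"
        unfolding sat_new by auto
      then obtain b where b: "b \<in> base (N a)"
        "\<And>\<chi>. \<chi> \<in> X\<^sub>0 \<Longrightarrow> sat (N a) ((snd \<circ> w)(z := b)) \<chi> \<longleftrightarrow> \<chi> \<in> U"
        unfolding holds_rlz[OF a(1), of "snd \<circ> w"] by blast
      have "agree (insert z V) \<Theta> X (v(z := p)) (w(z := (a, b)))"
      proof (rule agree_extend[OF vw z X'])
        show "fst (v x) = fst p \<longleftrightarrow> fst (w x) = fst (a, b)" if "x \<in> V" for x
          using False a(4)[OF that] that by auto
        show "sat M (fst \<circ> v(z := p)) \<theta> \<longleftrightarrow> sat M (fst \<circ> w(z := (a, b))) \<theta>" if "\<theta> \<in> \<Theta>" for \<theta>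
          using a(2)[OF that] that by (simp add: fun_upd_comp T_def)
        show "sat (N (fst p)) (snd \<circ> v(z := p)) \<chi> \<longleftrightarrow>
            sat (N (fst (a, b))) (snd \<circ> w(z := (a, b))) \<chi>"
          if "\<chi> \<in> X" "\<And>x. x \<in> fv \<chi> \<Longrightarrow> x = z \<or> fst (v x) = fst p" for \<chi>
        proof -
          \<comment> \<open>No old point lies in the fibre of \<open>p\<close>, so \<open>z\<close>
            is the only possible free variable of \<open>\<chi>\<close>.\<close>
          have "\<chi> \<in> X\<^sub>0"
            using that X_fm(2)[OF that(1)] False by (auto simp: X\<^sub>0_def)
          then show ?thesis
            using b(2)[of \<chi>] by (simp add: fun_upd_comp U_def)
        qed
      qed
      moreover have "(a, b) \<in> base P"
        using a(1) b(1) by (simp add: base_P)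
      ultimately show ?thesis by blast
    qed
  qed
qed

text \<open>The guard in the third clause mentions only the first valuation. As the free variables
  of \<open>\<chi>\<close> lie in \<open>V\<close>, the first clause carries the guard over to the
  other one.\<close>

lemma agree_sym:
  assumes vw: "agree V \<Theta> X v w" and X: "fms_in V X"
  shows "agree V \<Theta> X w v"
proof (rule agreeI)
  show "fst (w x) = fst (w y) \<longleftrightarrow> fst (v x) = fst (v y)" if "x \<in> V" "y \<in> V" for x y
    using agreeD(1)[OF vw that] by simp
  show "sat M (fst \<circ> w) \<theta> \<longleftrightarrow> sat M (fst \<circ> v) \<theta>" if "\<theta> \<in> \<Theta>" for \<theta>
    using agreeD(2)[OF vw that] by simp
  show "sat (N (fst (w y))) (snd \<circ> w) \<chi> \<longleftrightarrow> sat (N (fst (v y))) (snd \<circ> v) \<chi>"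
    if y: "y \<in> V" and \<chi>: "\<chi> \<in> X" and eq: "\<And>x. x \<in> fv \<chi> \<Longrightarrow> fst (w x) = fst (w y)" for y \<chi>
  proof -
    have "fst (v x) = fst (v y)" if "x \<in> fv \<chi>" for x
      using agreeD(1)[OF vw _ y, of x] eq[OF that] X \<chi> that by (auto simp: fms_in_def)
    then show ?thesis
      using agreeD(3)[OF vw y \<chi>] by simp
  qed
qed

section \<open>Truth in the product depends on finitely many data\<close>

text \<open>Agreement is symmetric, so preserving truth in one direction suffices; for quantifiers
  this leaves only the forth step.\<close>

lemma determined_if:
  assumes "fms_in (fv \<phi>) \<Theta>" "fms_in (fv \<phi>) X"
    and "\<And>v w. range v \<subseteq> base P \<Longrightarrow> range w \<subseteq> base P \<Longrightarrow> agree (fv \<phi>) \<Theta> X v w \<Longrightarrow>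
      sat P v \<phi> \<Longrightarrow> sat P w \<phi>"
  shows "\<exists>\<Theta> X. fms_in (fv \<phi>) \<Theta> \<and> fms_in (fv \<phi>) X \<and>
    (\<forall>v w. range v \<subseteq> base P \<longrightarrow> range w \<subseteq> base P \<longrightarrow> agree (fv \<phi>) \<Theta> X v w \<longrightarrow>
      (sat P v \<phi> \<longleftrightarrow> sat P w \<phi>))"
proof (intro exI conjI allI impI)
  show "sat P v \<phi> \<longleftrightarrow> sat P w \<phi>"
    if "range v \<subseteq> base P" "range w \<subseteq> base P" "agree (fv \<phi>) \<Theta> X v w" for v w
    using assms(3)[OF that] assms(3)[OF that(2,1) agree_sym[OF that(3) assms(2)]] by blast
qed (use assms in auto)

text \<open>Induction on \<open>\<phi>\<close>: atoms are read off from the interpretation,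
  conjunctions unite the data of their parts, and a witness \<open>p\<close> for an existential
  formula is answered by the \<open>q\<close> of \<open>agree_forth\<close>.\<close>

lemma determined:
  assumes "formula_of (lang_Us L) \<phi>"
  shows "\<exists>\<Theta> X. fms_in (fv \<phi>) \<Theta> \<and> fms_in (fv \<phi>) X \<and>
    (\<forall>v w. range v \<subseteq> base P \<longrightarrow> range w \<subseteq> base P \<longrightarrow> agree (fv \<phi>) \<Theta> X v w \<longrightarrow>
      (sat P v \<phi> \<longleftrightarrow> sat P w \<phi>))"
  using assms
proof (induction \<phi>)
  case FBot
  show ?case
    by (rule determined_if[of _ "{}" "{}"]) (auto simp: fms_in_def)
next
  case (FEq x y)
  show ?case
  \<comment> \<open>Agreement on fibres gives equality of first coordinates; the same equation read
    in the common fibre gives that of the second ones.\<close>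
  proof (rule determined_if[of _ "{}" "{FEq x y}"])
    fix v w assume vw: "agree (fv (FEq x y)) {} {FEq x y} v w" and "sat P v (FEq x y)"
    then have eq: "v x = v y" by simp
    moreover have "sat (N (fst (v x))) (snd \<circ> v) (FEq x y) \<longleftrightarrow>
        sat (N (fst (w x))) (snd \<circ> w) (FEq x y)"
      by (rule agreeD(3)[OF vw]) (use eq in auto)
    ultimately show "sat P w (FEq x y)"
      using agreeD(1)[OF vw, of x y] by (simp add: prod_eq_iff)
  qed (auto simp: fms_in_def)
next
  case (FRel S xs)
  show ?case
  proof (cases S)
    case (Orig R)
    then have R: "L R = Some (length xs)"
      using FRel by simp
    show ?thesis
    proof (rule determined_if[of _ "{FRel R xs}" "{FRel R xs}"])
      fix v w assume v: "range v \<subseteq> base P" and w: "range w \<subseteq> base P"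
        and vw: "agree (fv (FRel S xs)) {FRel R xs} {FRel R xs} v w"
        and sat: "sat P v (FRel S xs)"
      have cls: "fst (v x) = fst (v y) \<longleftrightarrow> fst (w x) = fst (w y)" if "x \<in> set xs" "y \<in> set xs" for x y
        using agreeD(1)[OF vw] that by simp
      \<comment> \<open>The tuple is empty, meets two fibres or stays in one. The empty atom is
        independent of the valuation; the others are read in \<open>M\<close> and in the fibre
        respectively.\<close>
      consider "xs = []" | x y where "x \<in> set xs" "y \<in> set xs" "fst (v x) \<noteq> fst (v y)"
        | y where "y \<in> set xs" "\<And>x. x \<in> set xs \<Longrightarrow> fst (v x) = fst (v y)"
        by (metis list.set_intros(1) neq_Nil_conv)
      then show "sat P w (FRel S xs)"
      proof cases
        case 1
        then show ?thesis using sat by simp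
      next
        case (2 x y)
        have "sat M (fst \<circ> v) (FRel R xs) \<longleftrightarrow> sat M (fst \<circ> w) (FRel R xs)"
          by (rule agreeD(2)[OF vw]) simp
        moreover have "fst (w x) \<noteq> fst (w y)"
          using cls 2 by blast
        ultimately show ?thesis
          using sat sat_Orig_nonconst[OF v 2] sat_Orig_nonconst[OF w 2(1,2)] Orig by blast
      next
        case (3 y)
        have "sat (N (fst (v y))) (snd \<circ> v) (FRel R xs) \<longleftrightarrow>
            sat (N (fst (w y))) (snd \<circ> w) (FRel R xs)"
          by (rule agreeD(3)[OF vw]) (use 3(1) in \<open>auto intro: 3(2)\<close>)
        moreover have "fst (w x) = fst (w y)" if "x \<in> set xs" for x
          using cls 3 that by blast
        ultimately show ?thesis
          using sat sat_Orig_const[OF v R 3] sat_Orig_const[OF w R 3(1)] Orig by blast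
      qed
    qed (use R in \<open>auto simp: fms_in_def\<close>)
  next
    case (Unary R)
    then obtain n where R: "L R = Some n" and "length xs = Suc 0"
      using FRel by (auto split: if_splits)
    then obtain x where x: "xs = [x]"
      by (auto simp: length_Suc_conv)
    have map: "map f (replicate n x) = replicate n (f x)" for f :: "nat \<Rightarrow> 'a"
      by simp
    show ?thesis
    \<comment> \<open>The unary predicate at \<open>x\<close> is the atom of \<open>M\<close> with
      \<open>x\<close> repeated \<open>n\<close> times; for \<open>n = 0\<close> this atom is
      closed.\<close>
    proof (rule determined_if[of _ "{FRel R (replicate n x)}" "{}"])
      fix v w assume v: "range v \<subseteq> base P" and w: "range w \<subseteq> base P"
        and vw: "agree (fv (FRel S xs)) {FRel R (replicate n x)} {} v w"
        and sat: "sat P v (FRel S xs)"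
      then show "sat P w (FRel S xs)"
        using agreeD(2)[OF vw, of "FRel R (replicate n x)"] sat_Unary[OF v R, of x]
          sat_Unary[OF w R, of x] Unary x by simp
    qed (use R x in \<open>auto simp: fms_in_def\<close>)
  next
    case Same
    then have "length xs = Suc (Suc 0)"
      using FRel by simp
    then obtain x y where x: "xs = [x, y]"
      by (auto simp: length_Suc_conv)
    show ?thesis
    proof (rule determined_if[of _ "{}" "{}"])
      fix v w assume v: "range v \<subseteq> base P" and w: "range w \<subseteq> base P"
        and vw: "agree (fv (FRel S xs)) {} {} v w"
        and sat: "sat P v (FRel S xs)"
      then show "sat P w (FRel S xs)"
        using agreeD(1)[OF vw, of x y] sat_Same[OF v, of x y] sat_Same[OF w, of x y] Same x
        by (simp del: sat.simps)
    qed (auto simp: fms_in_def)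
  qed
next
  case (FNeg \<phi>)
  then show ?case by simp
next
  case (FConj \<phi> \<psi>)
  then have fm: "formula_of (lang_Us L) \<phi>" "formula_of (lang_Us L) \<psi>" by simp_all
  from FConj.IH(1)[OF fm(1)] obtain \<Theta>\<^sub>1 X\<^sub>1 where
    1: "fms_in (fv \<phi>) \<Theta>\<^sub>1" "fms_in (fv \<phi>) X\<^sub>1"
      "\<forall>v w. range v \<subseteq> base P \<longrightarrow> range w \<subseteq> base P \<longrightarrow> agree (fv \<phi>) \<Theta>\<^sub>1 X\<^sub>1 v w \<longrightarrow>
        (sat P v \<phi> \<longleftrightarrow> sat P w \<phi>)"
    by blast
  from FConj.IH(2)[OF fm(2)] obtain \<Theta>\<^sub>2 X\<^sub>2 where
    2: "fms_in (fv \<psi>) \<Theta>\<^sub>2" "fms_in (fv \<psi>) X\<^sub>2"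
      "\<forall>v w. range v \<subseteq> base P \<longrightarrow> range w \<subseteq> base P \<longrightarrow> agree (fv \<psi>) \<Theta>\<^sub>2 X\<^sub>2 v w \<longrightarrow>
        (sat P v \<psi> \<longleftrightarrow> sat P w \<psi>)"
    by blast
  show ?case
  proof (rule determined_if[of _ "\<Theta>\<^sub>1 \<union> \<Theta>\<^sub>2" "X\<^sub>1 \<union> X\<^sub>2"])
    show "fms_in (fv (FConj \<phi> \<psi>)) (\<Theta>\<^sub>1 \<union> \<Theta>\<^sub>2)" "fms_in (fv (FConj \<phi> \<psi>)) (X\<^sub>1 \<union> X\<^sub>2)"
      using 1(1,2) 2(1,2) by (auto simp: fms_in_def)
    fix v w assume v: "range v \<subseteq> base P" and w: "range w \<subseteq> base P"
      and vw: "agree (fv (FConj \<phi> \<psi>)) (\<Theta>\<^sub>1 \<union> \<Theta>\<^sub>2) (X\<^sub>1 \<union> X\<^sub>2) v w" and "sat P v (FConj \<phi> \<psi>)"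
    moreover have "agree (fv \<phi>) \<Theta>\<^sub>1 X\<^sub>1 v w" "agree (fv \<psi>) \<Theta>\<^sub>2 X\<^sub>2 v w"
      by (rule agree_mono[OF vw]; simp)+
    ultimately show "sat P w (FConj \<phi> \<psi>)"
      using 1(3)[rule_format, of v w] 2(3)[rule_format, of v w] by simp
  qed
next
  case (FEx z \<phi>)
  then have "formula_of (lang_Us L) \<phi>" by simp
  from FEx.IH[OF this] obtain \<Theta> X where
    IH: "fms_in (fv \<phi>) \<Theta>" "fms_in (fv \<phi>) X"
      "\<forall>v w. range v \<subseteq> base P \<longrightarrow> range w \<subseteq> base P \<longrightarrow> agree (fv \<phi>) \<Theta> X v w \<longrightarrow>
        (sat P v \<phi> \<longleftrightarrow> sat P w \<phi>)"
    by blast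
  let ?V = "fv \<phi> - {z}"
  \<comment> \<open>Only an inclusion, since \<open>z\<close> may fail to occur in
    \<open>\<phi>\<close>; the data are enlarged to \<open>insert z ?V\<close> for the forth
    step.\<close>
  have sub: "fv \<phi> \<subseteq> insert z ?V" by auto
  obtain \<Theta>' X' where \<Theta>': "fms_in ?V \<Theta>'" and X': "fms_in ?V X'" and
    forth: "\<And>v w p. range v \<subseteq> base P \<Longrightarrow> range w \<subseteq> base P \<Longrightarrow> agree ?V \<Theta>' X' v w \<Longrightarrow>
      p \<in> base P \<Longrightarrow> \<exists>q\<in>base P. agree (insert z ?V) \<Theta> X (v(z := p)) (w(z := q))"
    by (rule agree_forth[OF _ _ fms_in_mono[OF IH(1) sub] fms_in_mono[OF IH(2) sub]])
      (simp_all add: finite_fv)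
  show ?case
  proof (rule determined_if[of _ \<Theta>' X'])
    fix v w assume v: "range v \<subseteq> base P" and w: "range w \<subseteq> base P"
      and vw: "agree (fv (FEx z \<phi>)) \<Theta>' X' v w" and "sat P v (FEx z \<phi>)"
    then obtain p where p: "p \<in> base P" "sat P (v(z := p)) \<phi>" by auto
    from vw have "agree ?V \<Theta>' X' v w" by simp
    from forth[OF v w this p(1)] obtain q where
      q: "q \<in> base P" "agree (insert z ?V) \<Theta> X (v(z := p)) (w(z := q))"
      by blast
    have "range (v(z := p)) \<subseteq> base P" "range (w(z := q)) \<subseteq> base P"
      using v w p(1) q(1) by auto
    then have "sat P (w(z := q)) \<phi>"
      using IH(3)[rule_format, of "v(z := p)" "w(z := q)"] agree_mono[OF q(2) sub] p(2) by blast
    then show "sat P w (FEx z \<phi>)"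
      using q(1) by auto
  qed (use \<Theta>' X' in simp_all)
qed

section \<open>Quantifier-free translations into the product\<close>

text \<open>\<open>x\<close> is a spare variable granted to the translation, for formulas
  \<open>\<theta>\<close> that provide no variable of their own.\<close>

definition lifts_M :: "nat \<Rightarrow> 'r fm \<Rightarrow> 'r usym fm \<Rightarrow> bool" where
  "lifts_M x \<theta> \<psi> \<longleftrightarrow> formula_of (lang_Us L) \<psi> \<and> qfree \<psi> \<and> fv \<psi> \<subseteq> insert x (fv \<theta>) \<and>
     (\<forall>v. range v \<subseteq> base P \<longrightarrow> (sat P v \<psi> \<longleftrightarrow> sat M (fst \<circ> v) \<theta>))"

text \<open>\<open>y\<close> names the fibre. The meaning of \<open>\<psi>\<close> is prescribed
  only where all free variables of \<open>\<chi>\<close> lie in that fibre, which is all that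
  \<open>agree\<close> asks about.\<close>

definition lifts_N :: "nat \<Rightarrow> 'r fm \<Rightarrow> 'r usym fm \<Rightarrow> bool" where
  "lifts_N y \<chi> \<psi> \<longleftrightarrow> formula_of (lang_Us L) \<psi> \<and> qfree \<psi> \<and> fv \<psi> \<subseteq> insert y (fv \<chi>) \<and>
     (\<forall>v. range v \<subseteq> base P \<longrightarrow> (\<forall>x\<in>fv \<chi>. fst (v x) = fst (v y)) \<longrightarrow>
       (sat P v \<psi> \<longleftrightarrow> sat (N (fst (v y))) (snd \<circ> v) \<chi>))"

text \<open>On a tuple inside one fibre \<open>Orig R\<close> speaks of that fibre and forgets
  \<open>M\<close>, which \<open>Unary R\<close> makes up for. A tuple meeting two fibres is
  governed by \<open>M\<close> through \<open>Orig R\<close>, and equality in \<open>M\<close>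
  becomes \<open>Same\<close>.\<close>

lemma lift_M_qfree:
  assumes "formula_of L \<theta>" "qfree \<theta>"
  shows "\<exists>\<psi>. lifts_M x \<theta> \<psi>"
  using assms
proof (induction \<theta>)
  case FBot
  show ?case by (rule exI[of _ FBot]) (simp add: lifts_M_def)
next
  case (FEq y z)
  show ?case
    by (rule exI[of _ "FRel Same [y, z]"]) (auto simp: lifts_M_def sat_Same simp del: sat.simps(3))
next
  case (FRel R xs)
  then have R: "L R = Some (length xs)" by simp
  define S where "S = (\<lambda>(y, z). FRel (Same :: 'r usym) [y, z]) ` (set xs \<times> set xs)"
  \<comment> \<open>\<open>c\<close> asserts all of \<open>S\<close>, that is, that the variables of
    \<open>xs\<close> share a fibre. For \<open>xs = []\<close> it is truth, so the nullary case
    also goes through \<open>Unary R\<close>.\<close>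
  define c where "c = diagram S S"
  \<comment> \<open>A nullary symbol is translated using the spare variable \<open>x\<close>.\<close>
  define y where "y = (if xs = [] then x else hd xs)"
  define \<psi> where "\<psi> = disj {FConj c (FRel (Unary R) [y]), FConj (FNeg c) (FRel (Orig R) xs)}"
  have finS: "finite S" by (simp add: S_def)
  have y: "y \<in> insert x (set xs)" by (simp add: y_def)
  have "sat P v \<psi> \<longleftrightarrow> sat M (fst \<circ> v) (FRel R xs)" if v: "range v \<subseteq> base P" for v
  proof -
    have c: "sat P v c \<longleftrightarrow> (\<forall>x\<in>set xs. \<forall>y\<in>set xs. fst (v x) = fst (v y))"
      unfolding c_def sat_diagram[OF finS] by (auto simp: S_def sat_Same[OF v] simp del: sat.simps)
    show ?thesis
    proof (cases "sat P v c")
      case True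
      have "map (fst \<circ> v) xs = replicate (length xs) (fst (v y))"
      proof (rule replicate_eqI)
        fix a assume "a \<in> set (map (fst \<circ> v) xs)"
        then obtain z where z: "z \<in> set xs" "a = fst (v z)" by auto
        then have "y \<in> set xs" by (auto simp: y_def)
        then show "a = fst (v y)"
          using True c z by blast
      qed simp
      then show ?thesis
        using True sat_Unary[OF v R, of y] by (simp add: \<psi>_def disj_simps)
    next
      case False
      then obtain x y where "x \<in> set xs" "y \<in> set xs" "fst (v x) \<noteq> fst (v y)"
        using c by blast
      then show ?thesis
        using False sat_Orig_nonconst[OF v, of x xs y R] by (simp add: \<psi>_def disj_simps)
    qed
  qed
  moreover have "formula_of (lang_Us L) \<psi>" "qfree \<psi>" "fv \<psi> \<subseteq> insert x (fv (FRel R xs))"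
    using finS R y by (auto simp: \<psi>_def disj_simps c_def diagram_simps S_def)
  ultimately show ?case unfolding lifts_M_def by blast
next
  case (FNeg \<theta>)
  then obtain \<psi> where "lifts_M x \<theta> \<psi>" by auto
  then have "lifts_M x (FNeg \<theta>) (FNeg \<psi>)"
    by (simp add: lifts_M_def)
  then show ?case by blast
next
  case (FConj \<theta>\<^sub>1 \<theta>\<^sub>2)
  then obtain \<psi>\<^sub>1 \<psi>\<^sub>2 where "lifts_M x \<theta>\<^sub>1 \<psi>\<^sub>1" "lifts_M x \<theta>\<^sub>2 \<psi>\<^sub>2" by auto
  then have "lifts_M x (FConj \<theta>\<^sub>1 \<theta>\<^sub>2) (FConj \<psi>\<^sub>1 \<psi>\<^sub>2)"
    unfolding lifts_M_def by (auto simp del: comp_apply)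
  then show ?case by blast
qed simp

lemma lift_M:
  assumes QE: "eliminates_quantifiers L M" and \<theta>: "formula_of L \<theta>"
  shows "\<exists>\<psi>. lifts_M x \<theta> \<psi>"
proof -
  obtain \<theta>' where \<theta>': "formula_of L \<theta>'" "qfree \<theta>'" "fv \<theta>' \<subseteq> fv \<theta>" "equiv_in M \<theta> \<theta>'"
    using QE \<theta> unfolding eliminates_quantifiers_def by blast
  obtain \<psi> where \<psi>: "lifts_M x \<theta>' \<psi>"
    using lift_M_qfree[OF \<theta>'(1,2)] by blast
  have "sat P v \<psi> \<longleftrightarrow> sat M (fst \<circ> v) \<theta>" if v: "range v \<subseteq> base P" for v
  proof -
    have "range (fst \<circ> v) \<subseteq> base M"
      using fst_base[OF v] by auto
    then show ?thesis
      using \<psi> v \<theta>'(4) unfolding lifts_M_def equiv_in_def by blast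
  qed
  then have "lifts_M x \<theta> \<psi>"
    using \<psi> \<theta>'(3) unfolding lifts_M_def by blast
  then show ?thesis ..
qed

text \<open>The truth of \<open>\<sigma>\<close> in a fibre is a definable condition on its index in
  \<open>M\<close>, hence a quantifier-free one there, hence quantifier-free in the product.\<close>

lemma lift_sentence:
  assumes QE: "eliminates_quantifiers L M" and \<sigma>: "sentence_of L \<sigma>"
  shows "\<exists>\<psi>. formula_of (lang_Us L) \<psi> \<and> qfree \<psi> \<and> fv \<psi> \<subseteq> {y} \<and>
    (\<forall>v. range v \<subseteq> base P \<longrightarrow> (sat P v \<psi> \<longleftrightarrow> holds (N (fst (v y))) \<sigma>))"
proof -
  obtain \<theta> where \<theta>: "formula_of L \<theta>" "fv \<theta> \<subseteq> {y}"
    "\<And>w. w y \<in> base M \<Longrightarrow> sat M w \<theta> \<longleftrightarrow> holds (N (w y)) \<sigma>"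
    using ex_definable_at[OF \<sigma>] by blast
  obtain \<psi> where "lifts_M y \<theta> \<psi>"
    using lift_M[OF QE \<theta>(1)] by blast
  moreover have "sat M (fst \<circ> v) \<theta> \<longleftrightarrow> holds (N (fst (v y))) \<sigma>" if "range v \<subseteq> base P" for v
    using \<theta>(3)[of "fst \<circ> v"] fst_base[OF that] by simp
  ultimately show ?thesis
    using \<theta>(2) unfolding lifts_M_def by (intro exI[of _ \<psi>]) auto
qed

text \<open>Inside a single fibre, equality and the nonnullary \<open>Orig R\<close> mean the same
  in the product as in the fibre, so the translation is mere relabelling. A nullary symbol is a
  sentence, handled by \<open>lift_sentence\<close>.\<close>

lemma lift_N_qfree:
  assumes QE: "eliminates_quantifiers L M" and "formula_of L \<chi>" "qfree \<chi>"
  shows "\<exists>\<psi>. lifts_N y \<chi> \<psi>"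
  using assms(2,3)
proof (induction \<chi>)
  case FBot
  show ?case by (rule exI[of _ FBot]) (simp add: lifts_N_def)
next
  case (FEq x z)
  show ?case
    by (rule exI[of _ "FEq x z"]) (auto simp: lifts_N_def prod_eq_iff)
next
  case (FRel R xs)
  then have R: "L R = Some (length xs)" by simp
  show ?case
  proof (cases "xs = []")
    case True
    \<comment> \<open>In the product, a nullary symbol only says that it holds in \<^emph>\<open>some\<close> fibre.\<close>
    then have sent: "sentence_of L (FRel R [])"
      using R by (simp add: sentence_of_def)
    obtain \<psi> where \<psi>: "formula_of (lang_Us L) \<psi>" "qfree \<psi>" "fv \<psi> \<subseteq> {y}"
      "\<And>v. range v \<subseteq> base P \<Longrightarrow> sat P v \<psi> \<longleftrightarrow> holds (N (fst (v y))) (FRel R [])"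
      using lift_sentence[OF QE sent] by metis
    have "sat P v \<psi> \<longleftrightarrow> sat (N (fst (v y))) (snd \<circ> v) (FRel R [])" if v: "range v \<subseteq> base P" for v
      unfolding \<psi>(4)[OF v] by (rule sat_sentence) (use base_N[OF fst_base[OF v]] in auto)
    with \<psi> True show ?thesis by (intro exI[of _ \<psi>]) (auto simp: lifts_N_def)
  next
    case False
    then obtain z where z: "z \<in> set xs" by (meson list.set_sel(1))
    have "sat P v (FRel (Orig R) xs) \<longleftrightarrow> sat (N (fst (v y))) (snd \<circ> v) (FRel R xs)"
      if v: "range v \<subseteq> base P" and "\<forall>x\<in>set xs. fst (v x) = fst (v y)" for v
      using sat_Orig_const[OF v R z] that(2) z by simp
    with R show ?thesis by (intro exI[of _ "FRel (Orig R) xs"]) (auto simp: lifts_N_def simp del: sat.simps comp_apply)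
  qed
next
  case (FNeg \<chi>)
  then obtain \<psi> where "lifts_N y \<chi> \<psi>" by auto
  then have "lifts_N y (FNeg \<chi>) (FNeg \<psi>)"
    by (simp add: lifts_N_def)
  then show ?case by blast
next
  case (FConj \<chi>\<^sub>1 \<chi>\<^sub>2)
  then obtain \<psi>\<^sub>1 \<psi>\<^sub>2 where "lifts_N y \<chi>\<^sub>1 \<psi>\<^sub>1" "lifts_N y \<chi>\<^sub>2 \<psi>\<^sub>2" by auto
  then have "lifts_N y (FConj \<chi>\<^sub>1 \<chi>\<^sub>2) (FConj \<psi>\<^sub>1 \<psi>\<^sub>2)"
    unfolding lifts_N_def by (auto simp del: comp_apply)
  then show ?case by blast
qed simp

text \<open>Which \<open>\<Phi> i\<close> is equivalent to \<open>\<chi>\<close> depends on the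
  fibre, but the equivalence is a sentence. So \<open>lift_sentence\<close> gives a quantifier-free
  \<open>\<delta> i\<close> in \<open>y\<close> testing it, and \<open>\<tau> i\<close> translates
  \<open>\<Phi> i\<close> itself.\<close>

lemma lift_N:
  fixes f :: "'b \<Rightarrow> 'c"
  assumes QE: "eliminates_quantifiers L M"
    and QE_N: "uniform_QE TYPE('c) L (common_theory L M N)" and f: "inj f"
    and \<chi>: "formula_of L \<chi>"
  shows "\<exists>\<psi>. lifts_N y \<chi> \<psi>"
proof -
  obtain k :: nat and \<Phi> where
    \<Phi>: "\<And>i. i < k \<Longrightarrow> formula_of L (\<Phi> i) \<and> qfree (\<Phi> i) \<and> fv (\<Phi> i) \<subseteq> fv \<chi>" and
    ex: "\<And>a. a \<in> base M \<Longrightarrow> \<exists>i<k. equiv_in (N a) \<chi> (\<Phi> i)"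
    using uniform_QE_members[OF QE_N f N \<chi>] by metis
  have "\<exists>\<psi>. formula_of (lang_Us L) \<psi> \<and> qfree \<psi> \<and> fv \<psi> \<subseteq> {y} \<and>
      (\<forall>v. range v \<subseteq> base P \<longrightarrow> (sat P v \<psi> \<longleftrightarrow> equiv_in (N (fst (v y))) \<chi> (\<Phi> i)))"
    if i: "i < k" for i
  proof -
    obtain \<sigma> where \<sigma>: "sentence_of L \<sigma>"
      "\<And>K :: ('r, 'b) fo_struct. base K \<noteq> {} \<Longrightarrow> holds K \<sigma> \<longleftrightarrow> equiv_in K \<chi> (\<Phi> i)"
      using equivalence_sentence[OF \<chi>] \<Phi>[OF i] by metis
    then show ?thesis
      using lift_sentence[OF QE \<sigma>(1), of y] fst_base base_N by metis
  qed
  then obtain \<delta> where \<delta>: "\<And>i. i < k \<Longrightarrow> formula_of (lang_Us L) (\<delta> i) \<and> qfree (\<delta> i) \<and> fv (\<delta> i) \<subseteq> {y}"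
    "\<And>i v. i < k \<Longrightarrow> range v \<subseteq> base P \<Longrightarrow> sat P v (\<delta> i) \<longleftrightarrow> equiv_in (N (fst (v y))) \<chi> (\<Phi> i)"
    by metis
  have "\<exists>\<tau>. lifts_N y (\<Phi> i) \<tau>" if "i < k" for i
    using lift_N_qfree[OF QE] \<Phi> that by simp
  then obtain \<tau> where \<tau>: "\<And>i. i < k \<Longrightarrow> lifts_N y (\<Phi> i) (\<tau> i)"
    by metis
  \<comment> \<open>Several \<open>\<delta> i\<close> may hold at once; every such
    \<open>\<tau> i\<close> then has the truth value of \<open>\<chi>\<close>, so the disjunction is
    unambiguous.\<close>
  define \<psi> where "\<psi> = disj ((\<lambda>i. FConj (\<delta> i) (\<tau> i)) ` {..<k})"
  have "sat P v \<psi> \<longleftrightarrow> sat (N (fst (v y))) (snd \<circ> v) \<chi>"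
    if v: "range v \<subseteq> base P" and eq: "\<forall>x\<in>fv \<chi>. fst (v x) = fst (v y)" for v
  proof -
    let ?K = "N (fst (v y))"
    have K: "snd (v x) \<in> base ?K" if "x \<in> fv \<chi>" for x
      using snd_base[OF v, of x] eq that by simp
    have \<tau>_iff: "sat P v (\<tau> i) \<longleftrightarrow> sat ?K (snd \<circ> v) \<chi>" if i: "i < k" and e: "equiv_in ?K \<chi> (\<Phi> i)" for i
    proof -
      have "sat P v (\<tau> i) \<longleftrightarrow> sat ?K (snd \<circ> v) (\<Phi> i)"
        using \<tau>[OF i] v eq \<Phi>[OF i] unfolding lifts_N_def by blast
      also have "\<dots> \<longleftrightarrow> sat ?K (snd \<circ> v) \<chi>"
        by (rule sat_eq_if_equiv_in[OF e base_N[OF fst_base[OF v]], symmetric])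
          (use K \<Phi>[OF i] in auto)
      finally show ?thesis .
    qed
    have "sat P v \<psi> \<longleftrightarrow> (\<exists>i<k. equiv_in ?K \<chi> (\<Phi> i) \<and> sat P v (\<tau> i))"
      by (auto simp: \<psi>_def disj_simps \<delta>(2)[OF _ v])
    also have "\<dots> \<longleftrightarrow> sat ?K (snd \<circ> v) \<chi>"
      using \<tau>_iff ex[OF fst_base[OF v, of y]] by blast
    finally show ?thesis .
  qed
  moreover have "formula_of (lang_Us L) \<psi>" "qfree \<psi>" "fv \<psi> \<subseteq> insert y (fv \<chi>)"
    using \<delta>(1) \<tau> \<Phi> by (fastforce simp: \<psi>_def disj_simps lifts_N_def)+
  ultimately show ?thesis unfolding lifts_N_def by blast
qed

section \<open>Quantifier elimination in the product\<close>

text \<open>The data of \<open>determined\<close> are expressed by a finite set \<open>G\<close> of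
  quantifier-free formulas: \<open>same\<close> for the fibres, \<open>\<mu>\<close> for
  \<open>M\<close>, \<open>\<nu>\<close> for the structures in the fibres. Equal truth values on
  \<open>G\<close> thus yield \<open>agree\<close>, and \<open>qfree_equiv_if_determined\<close>
  applies.\<close>

lemma eliminates_quantifiers_lex_product:
  fixes f :: "'b \<Rightarrow> 'c"
  assumes QE: "eliminates_quantifiers L M"
    and QE_N: "uniform_QE TYPE('c) L (common_theory L M N)" and f: "inj f"
  shows "eliminates_quantifiers (lang_Us L) P"
  unfolding eliminates_quantifiers_def
proof (intro allI impI)
  fix \<phi> assume \<phi>: "formula_of (lang_Us L) \<phi>"
  show "\<exists>\<psi>. formula_of (lang_Us L) \<psi> \<and> qfree \<psi> \<and> fv \<psi> \<subseteq> fv \<phi> \<and> equiv_in P \<phi> \<psi>"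
  proof (cases "fv \<phi> = {}")
    case True
    have "sat P v \<phi> \<longleftrightarrow> sat P w \<phi>" for v w
      by (rule sat_cong) (simp add: True)
    \<comment> \<open>Even the empty set of formulas determines a sentence, so a constant truth
      value is its equivalent.\<close>
    then show ?thesis
      by (intro qfree_equiv_if_determined[of "{}"]) auto
  next
    case False
    \<comment> \<open>This is the spare variable for \<open>lifts_M\<close>; being free in
      \<open>\<phi>\<close>, it adds no new free variable.\<close>
    then obtain x where x: "x \<in> fv \<phi>" by blast
    obtain \<Theta> X where \<Theta>: "fms_in (fv \<phi>) \<Theta>" and X: "fms_in (fv \<phi>) X" and
      det: "\<And>v w. range v \<subseteq> base P \<Longrightarrow> range w \<subseteq> base P \<Longrightarrow> agree (fv \<phi>) \<Theta> X v w \<Longrightarrow>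
        sat P v \<phi> \<longleftrightarrow> sat P w \<phi>"
      using determined[OF \<phi>] by metis
    have "\<exists>\<psi>. lifts_M x \<theta> \<psi>" if "\<theta> \<in> \<Theta>" for \<theta>
      using lift_M[OF QE] \<Theta> that by (simp add: fms_in_def)
    then obtain \<mu> where \<mu>: "\<And>\<theta>. \<theta> \<in> \<Theta> \<Longrightarrow> lifts_M x \<theta> (\<mu> \<theta>)"
      by metis
    define \<nu> where "\<nu> y \<chi> = (SOME \<psi>. lifts_N y \<chi> \<psi>)" for y \<chi>
    have \<nu>: "lifts_N y \<chi> (\<nu> y \<chi>)" if "\<chi> \<in> X" for y \<chi>
      unfolding \<nu>_def by (rule someI_ex) (use lift_N[OF QE QE_N f] X that in \<open>simp add: fms_in_def\<close>)
    define same where "same = (\<lambda>(y, z). FRel (Same :: 'r usym) [y, z])"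
    define G where "G = same ` (fv \<phi> \<times> fv \<phi>) \<union> \<mu> ` \<Theta> \<union> (\<lambda>(y, \<chi>). \<nu> y \<chi>) ` (fv \<phi> \<times> X)"
    show ?thesis
    proof (rule qfree_equiv_if_determined[of G])
      show "finite G"
        using \<Theta> X finite_fv[of \<phi>] by (simp add: G_def fms_in_def)
      have "fv (\<mu> \<theta>) \<subseteq> fv \<phi>" if "\<theta> \<in> \<Theta>" for \<theta>
        using \<mu>[OF that] \<Theta> that x by (auto simp: fms_in_def lifts_M_def)
      moreover have "fv (\<nu> y \<chi>) \<subseteq> fv \<phi>" if "y \<in> fv \<phi>" "\<chi> \<in> X" for y \<chi>
        using \<nu>[OF that(2), of y] X that by (auto simp: fms_in_def lifts_N_def)
      ultimately show "formula_of (lang_Us L) \<gamma> \<and> qfree \<gamma> \<and> fv \<gamma> \<subseteq> fv \<phi>" if "\<gamma> \<in> G" for \<gamma>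
        using that \<mu> \<nu> unfolding G_def lifts_M_def lifts_N_def
        by (elim UnE imageE SigmaE) (simp_all add: same_def)
    next
      fix v w assume v: "range v \<subseteq> base P" and w: "range w \<subseteq> base P"
        and G: "\<And>\<gamma>. \<gamma> \<in> G \<Longrightarrow> sat P v \<gamma> \<longleftrightarrow> sat P w \<gamma>"
      have cls: "fst (v y) = fst (v z) \<longleftrightarrow> fst (w y) = fst (w z)" if "y \<in> fv \<phi>" "z \<in> fv \<phi>" for y z
      proof -
        have "same (y, z) \<in> G" using that by (simp add: G_def)
        then show ?thesis
          using G[of "same (y, z)"] by (simp add: same_def sat_Same[OF v] sat_Same[OF w] del: sat.simps)
      qed
      have "agree (fv \<phi>) \<Theta> X v w"
      proof (rule agreeI)
        show "sat M (fst \<circ> v) \<theta> \<longleftrightarrow> sat M (fst \<circ> w) \<theta>" if "\<theta> \<in> \<Theta>" for \<theta>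
          using G[of "\<mu> \<theta>"] that \<mu>[OF that] v w by (simp add: G_def lifts_M_def)
        show "sat (N (fst (v y))) (snd \<circ> v) \<chi> \<longleftrightarrow> sat (N (fst (w y))) (snd \<circ> w) \<chi>"
          if y: "y \<in> fv \<phi>" and \<chi>: "\<chi> \<in> X" and eq: "\<And>x. x \<in> fv \<chi> \<Longrightarrow> fst (v x) = fst (v y)" for y \<chi>
        proof -
          \<comment> \<open>\<open>lifts_N\<close> has to be applied to \<open>w\<close> as well, so
            its guard is carried over from \<open>v\<close> by \<open>cls\<close>.\<close>
          have "fst (w x) = fst (w y)" if "x \<in> fv \<chi>" for x
            using eq[OF that] cls[of x y] that y \<chi> X by (auto simp: fms_in_def)
          moreover have "\<nu> y \<chi> \<in> G"
            using y \<chi> by (auto simp: G_def)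
          ultimately show ?thesis
            using G[of "\<nu> y \<chi>"] \<nu>[OF \<chi>, of y] v w eq unfolding lifts_N_def by blast
        qed
      qed (rule cls)
      then show "sat P v \<phi> \<longleftrightarrow> sat P w \<phi>"
        by (rule det[OF v w])
    qed
  qed
qed

end

theorem theorem2p5:
  fixes L :: "'r lang"
    and M :: "('r, 'a) fo_struct"
    and N :: "'a \<Rightarrow> ('r, 'b) fo_struct"
  assumes "structure_of L M"
    and "\<And>a. a \<in> base M \<Longrightarrow> structure_of L (N a)"
    and "\<And>\<phi>. sentence_of L \<phi> \<Longrightarrow> zero_definable L M {a \<in> base M. holds (N a) \<phi>}"
    and "uniform_QE TYPE('b + nat + 'r) L (common_theory L M N)"
    and "eliminates_quantifiers L M"
  shows "eliminates_quantifiers (lang_Us L) (lex_product L M N)"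
proof -
  interpret lex_product_setting L M N
    by unfold_locales (fact assms)+
  \<comment> \<open>\<open>Inl\<close> embeds \<open>'b\<close> into \<open>'b + nat + 'r\<close>,
    so every fibre has a copy among the models of the hypothesis.\<close>
  show ?thesis
    by (rule eliminates_quantifiers_lex_product[OF assms(5,4) inj_Inl])
qed

end
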